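(* Let $g:\mathbb{R}^d\to\mathbb{R}$ be concave and smooth, $\mathcal{B}:\mathbb{S}^n\to\mathbb{R}^d$ a linear map and $\alpha>0$. Consider the problem $$\max_X\ g(\mathcal{B}(X))\quad\text{subject to } \mathrm{Tr}(X)\le\alpha,\ X\succeq0. \qquad(\ast)$$ The output of the Frank-Wolfe algorithm with Gaussian sampling (described in the context) applied to $(\ast)$ with stopping parameter $\epsilon$ is a zero-mean Gaussian random vector $\widehat z_\epsilon$ with covariance $\widehat X_\epsilon$, where $\widehat X_\epsilon$ is an $\epsilon$-optimal solution of $(\ast)$. The working memory of the algorithm is $\mathcal{O}(n+d)$, where $d$ is the dimension of the image of $\mathcal{B}$.
   Context: $\mathbb{S}^n$: real symmetric $n\times n$ matrices; $\mathcal{B}^*$: adjoint of $\mathcal{B}$. A feasible point is $\epsilon$-optimal for a maximization problem if its objective value is at least the maximum minus $\epsilon$. Working memory: total memory (counted in stored numbers) used apart from that required to represent the problem instance; matrix-vector multiplication with matrices of the form $\mathcal{B}^*(\nabla g(v))$ is assumed available as a black box. Let $\mathcal{S}=\{X\succeq0:\mathrm{Tr}(X)\le\alpha\}$. The curvature constant of the objective $f(X)=g(\mathcal{B}(X))$ over $\mathcal{S}$ is $C_g=\sup -\frac{2}{\gamma^2}\left(f(Y)-f(X)-\langle Y-X,\nabla f(X)\rangle\right)$, the supremum being over $X,H\in\mathcal{S}$, $\gamma\in(0,1]$, $Y=X+\gamma(H-X)$; $C_g^u$ denotes a given upper bound on it. Frank-Wolfe algorithm with Gaussian sampling. Input: $\epsilon>0$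 (stopping criterion), $\eta\ge0$ (accuracy parameter), $p\in[0,1)$ (failure probability for the subproblem), $C_g^u$. Start from $X_0\in\mathcal{S}$ (say $X_0=\frac{\alpha}{n}I$), $v_0=\mathcal{B}(X_0)$, $z_0\sim\mathcal{N}(0,X_0)$. At iteration $t=0,1,2,\dots$, put $\gamma_t=\frac2{t+2}$ and $J_t=\mathcal{B}^*(\nabla g(v_t))$. The subroutine LMO finds (by the power method with random start, independently across calls) a unit vector $w_t$ such that with probability at least $1-p$, $\alpha w_t^TJ_tw_t\ge\alpha\lambda_{\max}(J_t)-\frac12\eta\gamma_tC_g^u$. If $w_t^TJ_tw_t\ge0$, set $q_t=\mathcal{B}(\alpha w_tw_t^T)$ and use the sampling direction $\sqrt\alpha\,w_t$; otherwise set $q_t=0$ and use the sampling direction $0$. If $\langle q_t-v_t,\nabla g(v_t)\rangle\le\epsilon$, stop and return $(z_t,v_t)$, with $\widehat z_\epsilon=z_t$. Otherwise set $z_{t+1}=\sqrt{1-\gamma_t}\,z_t+\sqrt{\gamma_t}\,\zeta_t\cdot(\text{sampling direction})$ with $\zeta_t\sim\mathcal{N}(0,1)$ independent of the past, and $v_{t+1}=(1-\gamma_t)v_t+\gamma_tq_t$. The matrix iterates $X_{t+1}=(1-\gamma_t)X_t+\gamma_tH_t$, $H_t=\alpha w_tw_t^T$ or $0$, are never stored.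
   Formalization: For an inexact LMO the ε-optimality claim is false; proved instead: (ε+δ)-optimality if the stopping call is δ-accurate, all calls accurate with probability ≥ (1-p)^(N+1) for T ≤ N, and ε-optimality a.s. if η=p=0. The Gaussian law is conditional on the LMO's randomness. *)

theory Defs
  imports "HOL-Probability.Probability"
begin

section \<open>The optimization problem\<close>

definition linear_on_sym :: "(real^'n^'n \<Rightarrow> real^'d) \<Rightarrow> bool" where
  "linear_on_sym B \<longleftrightarrow>
     (\<forall>X Y. transpose X = X \<longrightarrow> transpose Y = Y \<longrightarrow> B (X + Y) = B X + B Y) \<and>
     (\<forall>c X. transpose X = X \<longrightarrow> B (c *\<^sub>R X) = c *\<^sub>R B X)"

text \<open>
  The inner product of \<^typ>\<open>real^'n^'n\<close> is the sum over all entries, i.e. the trace inner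
  product.  The map \<open>B\<close> is only meaningful on symmetric matrices, so its adjoint is the
  symmetric matrix representing \<open>X \<mapsto> \<langle>y, B X\<rangle>\<close> on symmetric \<open>X\<close>; the library's \<open>adjoint\<close>,
  taken on all of \<^typ>\<open>real^'n^'n\<close>, need not be symmetric.
\<close>
definition adj_sym :: "(real^'n^'n \<Rightarrow> real^'d) \<Rightarrow> real^'d \<Rightarrow> real^'n^'n" where
  "adj_sym B y = (THE J. transpose J = J \<and>
                    (\<forall>X. transpose X = X \<longrightarrow> J \<bullet> X = y \<bullet> B X))"

definition grad :: "(real^'d \<Rightarrow> real) \<Rightarrow> real^'d \<Rightarrow> real^'d" where
  "grad g v = (THE D. GDERIV g v :> D)"

definition psd :: "real^'n^'n \<Rightarrow> bool" where
  "psd X \<longleftrightarrow> transpose X = X \<and> (\<forall>x. 0 \<le> x \<bullet> (X *v x))"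

definition lambda_max :: "real^'n^'n \<Rightarrow> real" where
  "lambda_max J = Max {l. \<exists>x. x \<noteq> 0 \<and> J *v x = l *\<^sub>R x}"

definition outer :: "real^'n \<Rightarrow> real^'n^'n" where
  "outer w = (\<chi> i j. w $ i * w $ j)"

text \<open>
  Data of the problem and of the algorithm.  The power method started at a random unit vector is
  run for \<open>iters t\<close> steps on \<open>J + shift t \<cdot> I\<close> in the \<open>t\<close>-th subproblem.  The shift makes the
  largest eigenvalue, rather than the one largest in modulus, dominant.
\<close>
record ('n, 'd) fw_input =
  obj :: "real^'d \<Rightarrow> real"
  lin :: "real^'n^'n \<Rightarrow> real^'d"
  bnd :: real
  eps :: real
  start :: "real^'n^'n"
  iters :: "nat \<Rightarrow> nat"
  shift :: "nat \<Rightarrow> real"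

definition feasible :: "('n::finite, 'd::finite) fw_input \<Rightarrow> (real^'n^'n) set" where
  "feasible P = {X. psd X \<and> trace X \<le> bnd P}"

definition objective :: "('n::finite, 'd::finite) fw_input \<Rightarrow> real^'n^'n \<Rightarrow> real" where
  "objective P X = obj P (lin P X)"

definition eps_optimal :: "('n::finite, 'd::finite) fw_input \<Rightarrow> real \<Rightarrow> real^'n^'n \<Rightarrow> bool" where
  "eps_optimal P e X \<longleftrightarrow>
     X \<in> feasible P \<and> objective P X \<ge> (SUP Y\<in>feasible P. objective P Y) - e"

text \<open>\<open>Jmat P (lin P X)\<close> is the gradient at \<open>X\<close> of the objective on symmetric matrices.\<close>
definition Jmat :: "('n::finite, 'd::finite) fw_input \<Rightarrow> real^'d \<Rightarrow> real^'n^'n" where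
  "Jmat P v = adj_sym (lin P) (grad (obj P) v)"

definition curvature :: "('n::finite, 'd::finite) fw_input \<Rightarrow> ereal" where
  "curvature P =
     (SUP (X, H, \<gamma>) \<in> feasible P \<times> feasible P \<times> {0<..1}.
        (let Y = X + \<gamma> *\<^sub>R (H - X) in
          ereal (- (2 / \<gamma>\<^sup>2) *
            (objective P Y - objective P X - (Y - X) \<bullet> Jmat P (lin P X)))))"


section \<open>The algorithm\<close>

text \<open>
  The iterates are functions of the realized random inputs: \<open>\<xi> t\<close> is the start vector of the
  \<open>t\<close>-th power method, \<open>\<zeta> t\<close> the \<open>t\<close>-th standard normal number and \<open>z0\<close> the initial sample.
  The recursions run on beyond the stopping time; only their values up to \<open>fw_T\<close> matter.
\<close>

definition step_size :: "nat \<Rightarrow> real" where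
  "step_size t = 2 / (real t + 2)"

text \<open>If the new power iterate vanishes, it cannot be normalized and the old one is kept.\<close>
definition power_step :: "real^'n^'n \<Rightarrow> real \<Rightarrow> real^'n \<Rightarrow> real^'n" where
  "power_step J \<sigma> w =
     (let u = J *v w + \<sigma> *\<^sub>R w in if u = 0 then w else (1 / norm u) *\<^sub>R u)"

definition LMO :: "('n::finite, 'd::finite) fw_input \<Rightarrow> nat \<Rightarrow> real^'d \<Rightarrow> real^'n \<Rightarrow> real^'n" where
  "LMO P t v x = (power_step (Jmat P v) (shift P t) ^^ iters P t) x"

definition lmo_accurate ::
  "('n::finite, 'd::finite) fw_input \<Rightarrow> real \<Rightarrow> real^'d \<Rightarrow> real^'n \<Rightarrow> bool" where
  "lmo_accurate P \<delta> v w \<longleftrightarrow>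
     bnd P * (w \<bullet> (Jmat P v *v w)) \<ge> bnd P * lambda_max (Jmat P v) - \<delta>"

definition ascent :: "('n::finite, 'd::finite) fw_input \<Rightarrow> real^'d \<Rightarrow> real^'n \<Rightarrow> bool" where
  "ascent P v w \<longleftrightarrow> 0 \<le> w \<bullet> (Jmat P v *v w)"

definition fw_H :: "('n::finite, 'd::finite) fw_input \<Rightarrow> real^'d \<Rightarrow> real^'n \<Rightarrow> real^'n^'n" where
  "fw_H P v w = (if ascent P v w then bnd P *\<^sub>R outer w else 0)"

definition fw_q :: "('n::finite, 'd::finite) fw_input \<Rightarrow> real^'d \<Rightarrow> real^'n \<Rightarrow> real^'d" where
  "fw_q P v w = (if ascent P v w then lin P (bnd P *\<^sub>R outer w) else 0)"

definition fw_dir :: "('n::finite, 'd::finite) fw_input \<Rightarrow> real^'d \<Rightarrow> real^'n \<Rightarrow> real^'n" where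
  "fw_dir P v w = (if ascent P v w then sqrt (bnd P) *\<^sub>R w else 0)"

primrec fw_v :: "('n::finite, 'd::finite) fw_input \<Rightarrow> (nat \<Rightarrow> real^'n) \<Rightarrow> nat \<Rightarrow> real^'d" where
  "fw_v P \<xi> 0 = lin P (start P)"
| "fw_v P \<xi> (Suc t) =
     (1 - step_size t) *\<^sub>R fw_v P \<xi> t
     + step_size t *\<^sub>R fw_q P (fw_v P \<xi> t) (LMO P t (fw_v P \<xi> t) (\<xi> t))"

definition fw_w :: "('n::finite, 'd::finite) fw_input \<Rightarrow> (nat \<Rightarrow> real^'n) \<Rightarrow> nat \<Rightarrow> real^'n" where
  "fw_w P \<xi> t = LMO P t (fw_v P \<xi> t) (\<xi> t)"

primrec fw_z ::
  "('n::finite, 'd::finite) fw_input \<Rightarrow> real^'n \<Rightarrow> (nat \<Rightarrow> real^'n) \<Rightarrow> (nat \<Rightarrow> real) \<Rightarrow> nat \<Rightarrow> real^'n" where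
  "fw_z P z0 \<xi> \<zeta> 0 = z0"
| "fw_z P z0 \<xi> \<zeta> (Suc t) =
     sqrt (1 - step_size t) *\<^sub>R fw_z P z0 \<xi> \<zeta> t
     + (sqrt (step_size t) * \<zeta> t) *\<^sub>R fw_dir P (fw_v P \<xi> t) (fw_w P \<xi> t)"

primrec fw_X :: "('n::finite, 'd::finite) fw_input \<Rightarrow> (nat \<Rightarrow> real^'n) \<Rightarrow> nat \<Rightarrow> real^'n^'n" where
  "fw_X P \<xi> 0 = start P"
| "fw_X P \<xi> (Suc t) =
     (1 - step_size t) *\<^sub>R fw_X P \<xi> t
     + step_size t *\<^sub>R fw_H P (fw_v P \<xi> t) (fw_w P \<xi> t)"

definition fw_stop :: "('n::finite, 'd::finite) fw_input \<Rightarrow> (nat \<Rightarrow> real^'n) \<Rightarrow> nat \<Rightarrow> bool" where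
  "fw_stop P \<xi> t \<longleftrightarrow>
     (fw_q P (fw_v P \<xi> t) (fw_w P \<xi> t) - fw_v P \<xi> t) \<bullet> grad (obj P) (fw_v P \<xi> t) \<le> eps P"

definition fw_T :: "('n::finite, 'd::finite) fw_input \<Rightarrow> (nat \<Rightarrow> real^'n) \<Rightarrow> nat" where
  "fw_T P \<xi> = (LEAST t. fw_stop P \<xi> t)"


section \<open>Gaussian laws, conditional laws, independence\<close>

definition normal_law :: "real \<Rightarrow> real measure" where
  "normal_law s2 =
     (if s2 = 0 then return borel 0 else density lborel (normal_density 0 (sqrt s2)))"

text \<open>
  The law \<open>N(0, S)\<close>, for possibly singular \<open>S\<close>: every linear functional \<open>x \<mapsto> a \<bullet> x\<close> is normal
  (possibly degenerate) with mean \<open>0\<close> and variance \<open>a \<bullet> S a\<close>.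
\<close>
definition is_gaussian :: "real^'n^'n \<Rightarrow> (real^'n) measure \<Rightarrow> bool" where
  "is_gaussian S \<mu> \<longleftrightarrow> prob_space \<mu> \<and> sets \<mu> = sets borel \<and>
     (\<forall>a. distr \<mu> borel (\<lambda>x. a \<bullet> x) = normal_law (a \<bullet> (S *v a)))"

text \<open>\<open>\<kappa>\<close> is a regular conditional distribution of \<open>Z\<close> given the \<open>\<sigma>\<close>-algebra \<open>F\<close>.\<close>
definition cond_gaussian ::
  "'a measure \<Rightarrow> 'a measure \<Rightarrow> ('a \<Rightarrow> real^'n) \<Rightarrow> ('a \<Rightarrow> real^'n^'n) \<Rightarrow> bool" where
  "cond_gaussian M F Z S \<longleftrightarrow>
     Z \<in> borel_measurable M \<and> S \<in> borel_measurable F \<and>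
     (\<exists>\<kappa>. (\<forall>\<omega>\<in>space M. is_gaussian (S \<omega>) (\<kappa> \<omega>)) \<and>
          (\<forall>C\<in>sets borel. AE \<omega> in M.
             real_cond_exp M F (indicator (Z -` C \<inter> space M)) \<omega> = measure (\<kappa> \<omega>) C))"

datatype source = Initial | Start nat | Noise nat

definition independent_inputs ::
  "'a measure \<Rightarrow> ('a \<Rightarrow> real^'n) \<Rightarrow> (nat \<Rightarrow> 'a \<Rightarrow> real^'n) \<Rightarrow> (nat \<Rightarrow> 'a \<Rightarrow> real) \<Rightarrow> bool" where
  "independent_inputs M z0 \<xi> \<zeta> \<longleftrightarrow>
     prob_space.indep_sets M
       (\<lambda>i. case i of
           Initial \<Rightarrow> {z0 -` A \<inter> space M | A. A \<in> sets borel}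
         | Start t \<Rightarrow> {\<xi> t -` A \<inter> space M | A. A \<in> sets borel}
         | Noise t \<Rightarrow> {\<zeta> t -` A \<inter> space M | A. A \<in> sets borel}) UNIV"


section \<open>Working memory\<close>

text \<open>
  A real-number machine with three kinds of registers, holding an element of \<open>\<real>\<^sup>n\<close>, of \<open>\<real>\<^sup>d\<close>
  or a single number.  The problem instance can be accessed only by evaluating \<open>\<nabla>g(v)\<close>, the product
  of \<open>B\<^sup>*(\<nabla>g(v))\<close> with a vector, and \<open>B(c x x\<^sup>T)\<close>, the arguments and results of
  which sit in registers, and by looking up the schedules of the power method.  Random inputs are
  read from one-way streams, so that a value not stored in a register is lost.
\<close>

datatype sexp =
    Num real
  | Reg nat
  | Add sexp sexp
  | Sub sexp sexp
  | Mul sexp sexp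
  | Dvd sexp sexp
  | Sqrt sexp
  | NDot nat nat
  | DDot nat nat
  | Iters sexp
  | Shift sexp

datatype com =
    SSet nat sexp
  | NComb nat sexp nat sexp nat
  | DComb nat sexp nat sexp nat
  | MatVec nat nat nat
  | Grad nat nat
  | Meas nat sexp nat
  | DrawStart nat
  | DrawNormal nat
  | Seq com com  (infixr \<open>;;\<close> 60)
  | IfLe sexp sexp com com
  | WhileLt sexp sexp com

record ('n, 'd) mstate =
  nreg :: "nat \<Rightarrow> real^'n"
  dreg :: "nat \<Rightarrow> real^'d"
  sreg :: "nat \<Rightarrow> real"
  starts :: "nat \<Rightarrow> real^'n"
  normals :: "nat \<Rightarrow> real"

primrec sval :: "('n::finite, 'd::finite) fw_input \<Rightarrow> ('n, 'd) mstate \<Rightarrow> sexp \<Rightarrow> real" where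
  "sval P s (Num c) = c"
| "sval P s (Reg i) = sreg s i"
| "sval P s (Add a b) = sval P s a + sval P s b"
| "sval P s (Sub a b) = sval P s a - sval P s b"
| "sval P s (Mul a b) = sval P s a * sval P s b"
| "sval P s (Dvd a b) = sval P s a / sval P s b"
| "sval P s (Sqrt a) = sqrt (sval P s a)"
| "sval P s (NDot i j) = nreg s i \<bullet> nreg s j"
| "sval P s (DDot i j) = dreg s i \<bullet> dreg s j"
| "sval P s (Iters a) = real (iters P (nat \<lfloor>sval P s a\<rfloor>))"
| "sval P s (Shift a) = shift P (nat \<lfloor>sval P s a\<rfloor>)"

inductive exec ::
  "('n::finite, 'd::finite) fw_input \<Rightarrow> com \<Rightarrow> ('n, 'd) mstate \<Rightarrow> ('n, 'd) mstate \<Rightarrow> bool"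
  for P where
  "exec P (SSet i a) s (s\<lparr>sreg := (sreg s)(i := sval P s a)\<rparr>)"
| "exec P (NComb i a j b k) s
     (s\<lparr>nreg := (nreg s)(i := sval P s a *\<^sub>R nreg s j + sval P s b *\<^sub>R nreg s k)\<rparr>)"
| "exec P (DComb i a j b k) s
     (s\<lparr>dreg := (dreg s)(i := sval P s a *\<^sub>R dreg s j + sval P s b *\<^sub>R dreg s k)\<rparr>)"
| "exec P (MatVec i j k) s (s\<lparr>nreg := (nreg s)(i := Jmat P (dreg s j) *v nreg s k)\<rparr>)"
| "exec P (Grad i j) s (s\<lparr>dreg := (dreg s)(i := grad (obj P) (dreg s j))\<rparr>)"
| "exec P (Meas i a k) s (s\<lparr>dreg := (dreg s)(i := lin P (sval P s a *\<^sub>R outer (nreg s k)))\<rparr>)"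
| "exec P (DrawStart i) s
     (s\<lparr>nreg := (nreg s)(i := starts s 0), starts := (\<lambda>m. starts s (Suc m))\<rparr>)"
| "exec P (DrawNormal i) s
     (s\<lparr>sreg := (sreg s)(i := normals s 0), normals := (\<lambda>m. normals s (Suc m))\<rparr>)"
| "exec P c1 s s' \<Longrightarrow> exec P c2 s' s'' \<Longrightarrow> exec P (c1 ;; c2) s s''"
| "sval P s a \<le> sval P s b \<Longrightarrow> exec P c1 s s' \<Longrightarrow> exec P (IfLe a b c1 c2) s s'"
| "\<not> sval P s a \<le> sval P s b \<Longrightarrow> exec P c2 s s' \<Longrightarrow> exec P (IfLe a b c1 c2) s s'"
| "\<not> sval P s a < sval P s b \<Longrightarrow> exec P (WhileLt a b c) s s"
| "sval P s a < sval P s b \<Longrightarrow> exec P c s s' \<Longrightarrow> exec P (WhileLt a b c) s' s'' \<Longrightarrow>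
     exec P (WhileLt a b c) s s''"

primrec sexp_sregs :: "sexp \<Rightarrow> nat set" where
  "sexp_sregs (Num c) = {}"
| "sexp_sregs (Reg i) = {i}"
| "sexp_sregs (Add a b) = sexp_sregs a \<union> sexp_sregs b"
| "sexp_sregs (Sub a b) = sexp_sregs a \<union> sexp_sregs b"
| "sexp_sregs (Mul a b) = sexp_sregs a \<union> sexp_sregs b"
| "sexp_sregs (Dvd a b) = sexp_sregs a \<union> sexp_sregs b"
| "sexp_sregs (Sqrt a) = sexp_sregs a"
| "sexp_sregs (NDot i j) = {}"
| "sexp_sregs (DDot i j) = {}"
| "sexp_sregs (Iters a) = sexp_sregs a"
| "sexp_sregs (Shift a) = sexp_sregs a"

primrec sexp_nregs :: "sexp \<Rightarrow> nat set" where
  "sexp_nregs (Num c) = {}"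
| "sexp_nregs (Reg i) = {}"
| "sexp_nregs (Add a b) = sexp_nregs a \<union> sexp_nregs b"
| "sexp_nregs (Sub a b) = sexp_nregs a \<union> sexp_nregs b"
| "sexp_nregs (Mul a b) = sexp_nregs a \<union> sexp_nregs b"
| "sexp_nregs (Dvd a b) = sexp_nregs a \<union> sexp_nregs b"
| "sexp_nregs (Sqrt a) = sexp_nregs a"
| "sexp_nregs (NDot i j) = {i, j}"
| "sexp_nregs (DDot i j) = {}"
| "sexp_nregs (Iters a) = sexp_nregs a"
| "sexp_nregs (Shift a) = sexp_nregs a"

primrec sexp_dregs :: "sexp \<Rightarrow> nat set" where
  "sexp_dregs (Num c) = {}"
| "sexp_dregs (Reg i) = {}"
| "sexp_dregs (Add a b) = sexp_dregs a \<union> sexp_dregs b"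
| "sexp_dregs (Sub a b) = sexp_dregs a \<union> sexp_dregs b"
| "sexp_dregs (Mul a b) = sexp_dregs a \<union> sexp_dregs b"
| "sexp_dregs (Dvd a b) = sexp_dregs a \<union> sexp_dregs b"
| "sexp_dregs (Sqrt a) = sexp_dregs a"
| "sexp_dregs (NDot i j) = {}"
| "sexp_dregs (DDot i j) = {i, j}"
| "sexp_dregs (Iters a) = sexp_dregs a"
| "sexp_dregs (Shift a) = sexp_dregs a"

primrec sexp_nodes :: "sexp \<Rightarrow> nat" where
  "sexp_nodes (Num c) = 1"
| "sexp_nodes (Reg i) = 1"
| "sexp_nodes (Add a b) = sexp_nodes a + sexp_nodes b + 1"
| "sexp_nodes (Sub a b) = sexp_nodes a + sexp_nodes b + 1"
| "sexp_nodes (Mul a b) = sexp_nodes a + sexp_nodes b + 1"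
| "sexp_nodes (Dvd a b) = sexp_nodes a + sexp_nodes b + 1"
| "sexp_nodes (Sqrt a) = sexp_nodes a + 1"
| "sexp_nodes (NDot i j) = 2"
| "sexp_nodes (DDot i j) = 2"
| "sexp_nodes (Iters a) = sexp_nodes a + 1"
| "sexp_nodes (Shift a) = sexp_nodes a + 1"

primrec com_sexps :: "com \<Rightarrow> sexp set" where
  "com_sexps (SSet i a) = {a}"
| "com_sexps (NComb i a j b k) = {a, b}"
| "com_sexps (DComb i a j b k) = {a, b}"
| "com_sexps (MatVec i j k) = {}"
| "com_sexps (Grad i j) = {}"
| "com_sexps (Meas i a k) = {a}"
| "com_sexps (DrawStart i) = {}"
| "com_sexps (DrawNormal i) = {}"
| "com_sexps (c1 ;; c2) = com_sexps c1 \<union> com_sexps c2"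
| "com_sexps (IfLe a b c1 c2) = {a, b} \<union> com_sexps c1 \<union> com_sexps c2"
| "com_sexps (WhileLt a b c) = {a, b} \<union> com_sexps c"

primrec com_temps :: "com \<Rightarrow> nat" where
  "com_temps (SSet i a) = sexp_nodes a"
| "com_temps (NComb i a j b k) = sexp_nodes a + sexp_nodes b"
| "com_temps (DComb i a j b k) = sexp_nodes a + sexp_nodes b"
| "com_temps (MatVec i j k) = 0"
| "com_temps (Grad i j) = 0"
| "com_temps (Meas i a k) = sexp_nodes a"
| "com_temps (DrawStart i) = 0"
| "com_temps (DrawNormal i) = 0"
| "com_temps (c1 ;; c2) = max (com_temps c1) (com_temps c2)"
| "com_temps (IfLe a b c1 c2) =
     max (sexp_nodes a + sexp_nodes b) (max (com_temps c1) (com_temps c2))"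
| "com_temps (WhileLt a b c) = max (sexp_nodes a + sexp_nodes b) (com_temps c)"

primrec com_nregs :: "com \<Rightarrow> nat set" where
  "com_nregs (SSet i a) = {}"
| "com_nregs (NComb i a j b k) = {i, j, k}"
| "com_nregs (DComb i a j b k) = {}"
| "com_nregs (MatVec i j k) = {i, k}"
| "com_nregs (Grad i j) = {}"
| "com_nregs (Meas i a k) = {k}"
| "com_nregs (DrawStart i) = {i}"
| "com_nregs (DrawNormal i) = {}"
| "com_nregs (c1 ;; c2) = com_nregs c1 \<union> com_nregs c2"
| "com_nregs (IfLe a b c1 c2) = com_nregs c1 \<union> com_nregs c2"
| "com_nregs (WhileLt a b c) = com_nregs c"

primrec com_dregs :: "com \<Rightarrow> nat set" where
  "com_dregs (SSet i a) = {}"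
| "com_dregs (NComb i a j b k) = {}"
| "com_dregs (DComb i a j b k) = {i, j, k}"
| "com_dregs (MatVec i j k) = {j}"
| "com_dregs (Grad i j) = {i, j}"
| "com_dregs (Meas i a k) = {i}"
| "com_dregs (DrawStart i) = {}"
| "com_dregs (DrawNormal i) = {}"
| "com_dregs (c1 ;; c2) = com_dregs c1 \<union> com_dregs c2"
| "com_dregs (IfLe a b c1 c2) = com_dregs c1 \<union> com_dregs c2"
| "com_dregs (WhileLt a b c) = com_dregs c"

primrec com_sregs :: "com \<Rightarrow> nat set" where
  "com_sregs (SSet i a) = {i}"
| "com_sregs (NComb i a j b k) = {}"
| "com_sregs (DComb i a j b k) = {}"
| "com_sregs (MatVec i j k) = {}"
| "com_sregs (Grad i j) = {}"
| "com_sregs (Meas i a k) = {}"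
| "com_sregs (DrawStart i) = {}"
| "com_sregs (DrawNormal i) = {i}"
| "com_sregs (c1 ;; c2) = com_sregs c1 \<union> com_sregs c2"
| "com_sregs (IfLe a b c1 c2) = com_sregs c1 \<union> com_sregs c2"
| "com_sregs (WhileLt a b c) = com_sregs c"

text \<open>
  Stored numbers: all registers a program mentions, one further vector of each kind
  as a result buffer (so that a target register may also be an argument), and, for the
  intermediate scalar results of a single command, one number per node of its expressions.
\<close>
definition working_memory :: "com \<Rightarrow> nat \<Rightarrow> nat \<Rightarrow> nat" where
  "working_memory c n d =
     n * (card (com_nregs c \<union> \<Union> (sexp_nregs ` com_sexps c)) + 1)
     + d * (card (com_dregs c \<union> \<Union> (sexp_dregs ` com_sexps c)) + 1)
     + card (com_sregs c \<union> \<Union> (sexp_sregs ` com_sexps c))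
     + com_temps c"

text \<open>
  Register use: \<open>\<real>\<^sup>n\<close>-registers 0, 1, 2 hold \<open>z\<close>, \<open>w\<close> and a matrix-vector product;
  \<open>\<real>\<^sup>d\<close>-registers 0, 1, 2 hold \<open>v\<close>, \<open>q\<close> and \<open>\<nabla>g(v)\<close>; number registers 0 to 6 hold
  \<open>t\<close>, the power iteration counter, a norm or quadratic form value, the length of the sampling
  direction, \<open>\<langle>q - v, \<nabla>g(v)\<rangle>\<close>, \<open>\<gamma>\<close> and \<open>\<zeta>\<close>.
\<close>
definition power_program :: com where
  "power_program =
     DrawStart 1 ;;
     SSet 1 (Num 0) ;;
     WhileLt (Reg 1) (Iters (Reg 0))
       (MatVec 2 0 1 ;;
        NComb 2 (Num 1) 2 (Shift (Reg 0)) 1 ;;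
        SSet 2 (Sqrt (NDot 2 2)) ;;
        IfLe (Reg 2) (Num 0)
          (SSet 2 (Num 0))
          (NComb 1 (Dvd (Num 1) (Reg 2)) 2 (Num 0) 1) ;;
        SSet 1 (Add (Reg 1) (Num 1)))"

definition direction_program :: "real \<Rightarrow> com" where
  "direction_program \<alpha> =
     power_program ;;
     MatVec 2 0 1 ;;
     SSet 2 (NDot 1 2) ;;
     IfLe (Num 0) (Reg 2)
       (Meas 1 (Num \<alpha>) 1 ;; SSet 3 (Sqrt (Num \<alpha>)))
       (DComb 1 (Num 0) 1 (Num 0) 1 ;; SSet 3 (Num 0)) ;;
     Grad 2 0 ;;
     SSet 4 (Sub (DDot 1 2) (DDot 0 2))"

definition fw_program :: "real \<Rightarrow> real \<Rightarrow> com" where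
  "fw_program \<alpha> \<epsilon> =
     SSet 0 (Num 0) ;;
     direction_program \<alpha> ;;
     WhileLt (Num \<epsilon>) (Reg 4)
       (SSet 5 (Dvd (Num 2) (Add (Reg 0) (Num 2))) ;;
        DrawNormal 6 ;;
        NComb 0 (Sqrt (Sub (Num 1) (Reg 5))) 0
                (Mul (Mul (Sqrt (Reg 5)) (Reg 6)) (Reg 3)) 1 ;;
        DComb 0 (Sub (Num 1) (Reg 5)) 0 (Reg 5) 1 ;;
        SSet 0 (Add (Reg 0) (Num 1)) ;;
        direction_program \<alpha>)"

definition init_state ::
  "real^'n \<Rightarrow> real^'d \<Rightarrow> (nat \<Rightarrow> real^'n) \<Rightarrow> (nat \<Rightarrow> real) \<Rightarrow> ('n::finite, 'd::finite) mstate" where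
  "init_state z0 v0 \<xi> \<zeta> =
     \<lparr>nreg = (\<lambda>i. if i = 0 then z0 else 0), dreg = (\<lambda>i. if i = 0 then v0 else 0),
      sreg = (\<lambda>i. 0), starts = \<xi>, normals = \<zeta>\<rparr>"

end

theory Submission
  imports Defs
begin

text \<open>
  The proof has three independent strands: an optimization argument that is valid for every
  realization of the random start vectors, a probabilistic argument that treats the start vectors
  as frozen, and a simulation argument for the register machine.

  \<^bold>\<open>Optimization.\<close>  Write \<open>f X = g (B X)\<close>.  Each iterate \<open>X\<^sub>t\<close> is a convex combination of
  feasible points, and \<open>v\<^sub>t = B X\<^sub>t\<close>.  As long as the stopping test fails, the curvature bound
  makes a step increase \<open>f\<close> by at least \<open>\<gamma>\<^sub>t \<epsilon> - \<gamma>\<^sub>t\<^sup>2 C/2\<close>, whatever the quality of the direction.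
  Since \<open>\<Sum> \<gamma>\<^sub>t\<close> diverges, \<open>\<Sum> \<gamma>\<^sub>t\<^sup>2\<close> converges and \<open>f\<close> is bounded above on the feasible set, the
  number of steps is bounded by a constant that depends on no random input
  (\<open>stopping_time_bounded\<close>).  When the test succeeds with a direction that is
  accurate up to \<open>\<delta>\<close>, the linearization of \<open>f\<close> at \<open>X\<^sub>t\<close>, which majorizes \<open>f\<close> by concavity, exceeds
  \<open>f X\<^sub>t\<close> by at most \<open>\<epsilon> + \<delta>\<close> on the feasible set (\<open>stop_imp_eps_optimal\<close>).  Behind this is the
  identity of the maximum of \<open>\<langle>X, J\<rangle>\<close> over the feasible set with
  \<open>\<alpha> max(0, \<lambda>\<^sub>m\<^sub>a\<^sub>x J)\<close>; the inequality \<open>inner_psd_le_lambda_max\<close> comes from writing a positive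
  semidefinite matrix as a sum of rank-one matrices.

  \<^bold>\<open>Probability.\<close>  The stopping time and the matrix iterates are functions of the start
  vectors alone, and these are independent of the initial sample and the normal numbers.  With the
  start vectors frozen, the stopping time is a constant and \<open>z\<^sub>t\<close> is a fixed linear combination of
  independent Gaussians, whose covariance obeys the recursion of \<open>X\<^sub>t\<close> (\<open>fw_z_gaussian\<close>).  Fubini's
  theorem turns this statement about frozen start vectors into one about the conditional law given
  the start vectors (\<open>real_cond_exp_freeze\<close>, \<open>output_cond_gaussian\<close>).  The output is thus Gaussian
  conditionally on the matrix it is to have as covariance, which is itself random.
  Freezing also shows that the first \<open>m\<close> subproblems are all solved accurately with probability at
  least \<open>(1 - p)\<^sup>m\<close>: given the past, each one concerns a fixed feasible point and a fresh start vector
  (\<open>prob_accurate\<close>).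

  \<^bold>\<open>Memory.\<close>  The machine program runs through states that represent the mathematical iterates
  (\<open>represents\<close>), by induction along its two loops, and its register use is read off its text.
\<close>

section \<open>Symmetric and positive semidefinite matrices\<close>

lemma matrix_inner_eq_sum:
  fixes A B :: "real^'n^'m"
  shows "A \<bullet> B = (\<Sum>i\<in>UNIV. \<Sum>j\<in>UNIV. A $ i $ j * B $ i $ j)"
  by (simp add: inner_vec_def)

lemma inner_transpose_transpose:
  fixes A B :: "real^'n^'m"
  shows "transpose A \<bullet> transpose B = A \<bullet> B"
  unfolding matrix_inner_eq_sum transpose_def by simp (rule sum.swap)

lemma inner_outer: "A \<bullet> outer w = w \<bullet> (A *v w)"
  by (simp add: matrix_inner_eq_sum outer_def inner_vec_def matrix_vector_mult_def
      sum_distrib_left mult_ac)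

lemma outer_mult_vector: "outer w *v x = (w \<bullet> x) *\<^sub>R w"
  by (simp add: vec_eq_iff outer_def inner_vec_def matrix_vector_mult_def sum_distrib_left mult_ac)

lemma transpose_outer: "transpose (outer w) = outer w"
  by (simp add: vec_eq_iff transpose_def outer_def mult.commute)

lemma trace_outer: "trace (outer w) = w \<bullet> w"
  by (simp add: trace_def outer_def inner_vec_def)

lemma norm_outer: "norm (outer w) = (norm w)\<^sup>2"
proof -
  have "(norm (outer w))\<^sup>2 = ((norm w)\<^sup>2)\<^sup>2"
    by (simp only: power2_norm_eq_inner inner_outer outer_mult_vector) (simp add: power2_eq_square)
  then show ?thesis by (rule power2_eq_imp_eq) simp_all
qed

lemma symmetric_inner_swap:
  fixes A :: "real^'n^'n"
  assumes "transpose A = A"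
  shows "x \<bullet> (A *v y) = y \<bullet> (A *v x)"
  by (metis assms dot_lmul_matrix inner_commute transpose_matrix_vector)

lemma transpose_add: "transpose (A + B) = transpose A + transpose (B :: real^'n^'m)"
  and transpose_diff: "transpose (A - B) = transpose A - transpose (B :: real^'n^'m)"
  and transpose_scaleR: "transpose (c *\<^sub>R A) = c *\<^sub>R transpose (A :: real^'n^'m)"
  and transpose_zero: "transpose (0 :: real^'n^'m) = 0"
  by (simp_all add: vec_eq_iff transpose_def)

lemma trace_scaleR: "trace (c *\<^sub>R A) = c * trace (A :: real^'n^'n)"
  by (simp add: trace_def sum_distrib_left)

lemma psd_0: "psd 0"
  by (simp add: psd_def transpose_zero)

lemma psd_outer: "psd (outer w)"
  by (simp add: psd_def transpose_outer outer_mult_vector inner_commute)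

lemma psd_add: "psd A \<Longrightarrow> psd B \<Longrightarrow> psd (A + B)"
  by (simp add: psd_def transpose_add matrix_vector_mult_add_rdistrib inner_add_right)

lemma psd_scaleR: "psd A \<Longrightarrow> 0 \<le> c \<Longrightarrow> psd (c *\<^sub>R A)"
  by (simp add: psd_def transpose_scaleR flip: scaleR_matrix_vector_assoc)

text \<open>
  The null vectors of the quadratic form are those of the matrix: otherwise the form would become
  negative at \<open>x + t (A x)\<close> for a small negative \<open>t\<close>.
\<close>
lemma psd_mult_eq_0:
  assumes "psd A" and x: "x \<bullet> (A *v x) = 0"
  shows "A *v x = 0"
proof (rule ccontr)
  assume "A *v x \<noteq> 0"
  define y where "y = A *v x"
  define b where "b = y \<bullet> y"
  define c where "c = y \<bullet> (A *v y)"
  have b: "b > 0" using \<open>A *v x \<noteq> 0\<close> by (simp add: b_def y_def)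
  have sym: "transpose A = A" and nn: "\<And>x. 0 \<le> x \<bullet> (A *v x)"
    using assms(1) unfolding psd_def by blast+
  have c: "c \<ge> 0" unfolding c_def by (rule nn)
  \<comment> \<open>The form at \<open>x + t y\<close> is \<open>t (2 b + t c)\<close>; this \<open>t\<close> keeps \<open>t c\<close> above \<open>-b\<close>, even if \<open>c = 0\<close>.\<close>
  define t where "t = - b / (c + 1)"
  have "y \<bullet> (A *v x) = b" by (simp add: b_def y_def)
  then have xy: "x \<bullet> (A *v y) = b" "y \<bullet> (A *v x) = b"
    using symmetric_inner_swap[OF sym, of x y] by simp_all
  have "0 \<le> (x + t *\<^sub>R y) \<bullet> (A *v (x + t *\<^sub>R y))" by (rule nn)
  also have "\<dots> = 2 * t * b + t\<^sup>2 * c"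
    by (simp add: matrix_vector_right_distrib matrix_vector_mult_scaleR inner_add_left
        inner_add_right xy x c_def[symmetric])
      (simp add: power2_eq_square algebra_simps)
  also have "\<dots> = t * (2 * b + t * c)" by (simp add: power2_eq_square distrib_left)
  also have "\<dots> < 0"
  proof (rule mult_neg_pos)
    show "t < 0" using b c by (simp add: t_def)
    have "t * c = - b * (c / (c + 1))" by (simp add: t_def)
    also have "\<dots> \<ge> - b * 1" using b c by (intro mult_left_mono_neg) auto
    finally show "2 * b + t * c > 0" using b by linarith
  qed
  finally show False by simp
qed

text \<open>
  A step of Cholesky's factorization along an arbitrary direction \<open>x\<close>.  What remains is positive
  semidefinite because its form at \<open>y\<close> is the form of \<open>Y\<close> at the \<open>Y\<close>-orthogonal projection of \<open>y\<close>
  off \<open>x\<close>.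
\<close>
lemma psd_diff_outer:
  assumes Y: "psd Y" and a: "x \<bullet> (Y *v x) > 0"
  defines "u \<equiv> (1 / sqrt (x \<bullet> (Y *v x))) *\<^sub>R (Y *v x)"
  shows "psd (Y - outer u)" "(Y - outer u) *v x = 0"
proof -
  define a where "a = x \<bullet> (Y *v x)"
  have a0: "a > 0" using assms by (simp add: a_def)
  have sym: "transpose Y = Y" and nn: "\<And>x. 0 \<le> x \<bullet> (Y *v x)"
    using Y unfolding psd_def by blast+
  have u: "u \<bullet> y = (x \<bullet> (Y *v y)) / sqrt a" for y
    unfolding symmetric_inner_swap[OF sym, of x y] by (simp add: u_def a_def inner_commute)
  have "0 \<le> y \<bullet> ((Y - outer u) *v y)" for y
  proof -
    define b where "b = x \<bullet> (Y *v y)"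
    have b': "y \<bullet> (Y *v x) = b" using symmetric_inner_swap[OF sym, of x y] by (simp add: b_def)
    have "0 \<le> (y - (b / a) *\<^sub>R x) \<bullet> (Y *v (y - (b / a) *\<^sub>R x))" by (rule nn)
    also have "\<dots> = y \<bullet> (Y *v y) - b * b / a"
      using a0 by (simp add: matrix_vector_mult_diff_distrib matrix_vector_mult_scaleR
          inner_diff_left inner_diff_right b' flip: a_def b_def)
    also have "\<dots> = y \<bullet> ((Y - outer u) *v y)"
      using a0 by (simp add: matrix_vector_mult_diff_rdistrib outer_mult_vector inner_diff_right
          u inner_commute[of y u] flip: b_def)
    finally show ?thesis .
  qed
  then show "psd (Y - outer u)"
    by (simp add: psd_def transpose_diff sym transpose_outer)
  have "(u \<bullet> x) *\<^sub>R u = Y *v x"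
    unfolding u using a0 by (simp add: u_def flip: a_def)
  then show "(Y - outer u) *v x = 0"
    by (simp add: matrix_vector_mult_diff_rdistrib outer_mult_vector)
qed

lemma symmetric_eq_0_if_quadratic_form_0:
  fixes A :: "real^'n^'n"
  assumes "transpose A = A" "\<And>x. x \<bullet> (A *v x) = 0"
  shows "A = 0"
proof -
  have "psd A" using assms by (simp add: psd_def)
  then have "A *v x = 0" for x using assms by (intro psd_mult_eq_0)
  then show ?thesis by (simp add: matrix_eq)
qed

text \<open>
  Every positive semidefinite matrix is a sum of rank-one matrices.  Splitting one off as in
  \<open>psd_diff_outer\<close> enlarges the kernel, so this ends by dimension.  As an induction
  principle the decomposition replaces the spectral theorem in what follows.
\<close>
lemma psd_induct [consumes 1, case_names zero outer]:
  fixes Y :: "real^'n^'n"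
  assumes "psd Y" and zero: "Q 0"
    and step: "\<And>Y u. psd Y \<Longrightarrow> Q Y \<Longrightarrow> Q (Y + outer u)"
  shows "Q Y"
  using assms(1)
proof (induction "DIM(real^'n) - dim {x. Y *v x = 0}" arbitrary: Y rule: less_induct)
  case less
  show ?case
  proof (cases "\<forall>x. x \<bullet> (Y *v x) = 0")
    case True
    then show ?thesis
      using less.prems symmetric_eq_0_if_quadratic_form_0[of Y] zero by (auto simp: psd_def)
  next
    case False
    then obtain x where x: "x \<bullet> (Y *v x) > 0"
      using less.prems by (metis less_eq_real_def psd_def)
    define u where "u = (1 / sqrt (x \<bullet> (Y *v x))) *\<^sub>R (Y *v x)"
    define Y' where "Y' = Y - outer u"
    have Y': "psd Y'" "Y' *v x = 0"
      using psd_diff_outer[OF less.prems x] by (simp_all add: u_def Y'_def)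
    have sub: "subspace {x. A *v x = 0}" for A :: "real^'n^'n"
      by (rule linear_subspace_kernel) simp
    have "Y' *v z = 0" if "Y *v z = 0" for z
    proof -
      have "transpose Y = Y" using less.prems by (simp add: psd_def)
      then have "z \<bullet> (Y *v x) = 0" using symmetric_inner_swap[of Y z x] that by simp
      then have "u \<bullet> z = 0" by (simp add: u_def inner_commute)
      then show ?thesis
        using that by (simp add: Y'_def matrix_vector_mult_diff_rdistrib outer_mult_vector)
    qed
    moreover have "Y *v x \<noteq> 0" using x by auto
    ultimately have "{z. Y *v z = 0} \<subset> {z. Y' *v z = 0}" using Y'(2) by auto
    then have "dim {z. Y *v z = 0} < dim {z. Y' *v z = 0}"
      using sub by (intro dim_psubset) (simp add: span_eq_iff[THEN iffD2])
    moreover have "dim {z. Y' *v z = 0} \<le> DIM(real^'n)" by (rule dim_subset_UNIV)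
    ultimately have "Q Y'" using less.hyps Y'(1) by auto
    from step[OF Y'(1) this, of u] show ?thesis by (simp add: Y'_def)
  qed
qed

lemma trace_psd_nonneg: "psd Y \<Longrightarrow> 0 \<le> trace Y"
proof (induction rule: psd_induct)
  case zero
  then show ?case by (simp add: trace_def)
next
  case (outer Y u)
  then show ?case by (simp add: trace_add trace_outer)
qed

text \<open>
  A maximizer \<open>x\<close> of the quadratic form on the unit sphere is an eigenvector: with \<open>l\<close> the maximum,
  \<open>l I - J\<close> is positive semidefinite and its form vanishes at \<open>x\<close>.
\<close>
lemma symmetric_top_eigenvector:
  fixes J :: "real^'n^'n"
  assumes sym: "transpose J = J"
  shows "\<exists>x. norm x = 1 \<and> J *v x = (x \<bullet> (J *v x)) *\<^sub>R x \<and>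
    (\<forall>y. y \<bullet> (J *v y) \<le> (x \<bullet> (J *v x)) * (y \<bullet> y))"
proof -
  have "continuous_on (sphere 0 1) (\<lambda>x. x \<bullet> (J *v x))"
    by (intro continuous_intros linear_continuous_on matrix_vector_mul_bounded_linear)
  moreover have "sphere (0 :: real^'n) 1 \<noteq> {}" by simp
  ultimately obtain x where x: "x \<in> sphere 0 1"
    and max: "\<And>y. y \<in> sphere 0 1 \<Longrightarrow> y \<bullet> (J *v y) \<le> x \<bullet> (J *v x)"
    using continuous_attains_sup[of "sphere 0 1" "\<lambda>x. x \<bullet> (J *v x)"] by auto
  define l where "l = x \<bullet> (J *v x)"
  have le: "y \<bullet> (J *v y) \<le> l * (y \<bullet> y)" for y
  proof (cases "y = 0")
    case False
    define y' where "y' = (1 / norm y) *\<^sub>R y"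
    have y: "y = norm y *\<^sub>R y'" using False by (simp add: y'_def)
    have "y' \<bullet> (J *v y') \<le> l" unfolding l_def by (rule max) (simp add: y'_def False)
    then have "(norm y)\<^sup>2 * (y' \<bullet> (J *v y')) \<le> (norm y)\<^sup>2 * l" by (intro mult_left_mono) auto
    moreover have "y \<bullet> (J *v y) = (norm y)\<^sup>2 * (y' \<bullet> (J *v y'))"
      by (subst (1 2) y) (simp add: matrix_vector_mult_scaleR power2_eq_square)
    ultimately show ?thesis by (simp add: power2_norm_eq_inner mult.commute)
  qed simp
  define A where "A = l *\<^sub>R mat 1 - J"
  have A: "A *v y = l *\<^sub>R y - J *v y" for y
    by (simp add: A_def matrix_vector_mult_diff_rdistrib flip: scaleR_matrix_vector_assoc)
  have "psd A" using le
    by (simp add: psd_def A inner_diff_right) (simp add: A_def transpose_diff transpose_scaleR sym)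
  moreover have "x \<bullet> x = 1" using x by (simp flip: power2_norm_eq_inner)
  then have "x \<bullet> (A *v x) = 0" by (simp add: A inner_diff_right l_def)
  ultimately have "A *v x = 0" by (rule psd_mult_eq_0)
  then show ?thesis using x le by (intro exI[of _ x]) (simp add: A l_def)
qed

text \<open>
  The maximum that defines \<open>lambda_max\<close> is meaningful only over a finite set.  Eigenvectors to
  distinct eigenvalues of a symmetric matrix are orthogonal, and there are at most \<open>n\<close> nonzero
  pairwise orthogonal vectors.
\<close>
lemma symmetric_finite_eigenvalues:
  fixes J :: "real^'n^'n"
  assumes sym: "transpose J = J"
  shows "finite {l. \<exists>x. x \<noteq> 0 \<and> J *v x = l *\<^sub>R x}" (is "finite ?E")
proof -
  define e where "e l = (SOME x. x \<noteq> 0 \<and> J *v x = l *\<^sub>R x)" for l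
  have e: "e l \<noteq> 0 \<and> J *v e l = l *\<^sub>R e l" if "l \<in> ?E" for l
    unfolding e_def
    using someI_ex[of "\<lambda>x. x \<noteq> 0 \<and> J *v x = l *\<^sub>R x"] that by blast
  have inj: "inj_on e ?E"
  proof
    fix l m assume lm: "l \<in> ?E" "m \<in> ?E" "e l = e m"
    have "l *\<^sub>R e l = J *v e l" by (rule e[OF lm(1), THEN conjunct2, symmetric])
    also have "\<dots> = m *\<^sub>R e m" unfolding lm(3) using e[OF lm(2)] by (rule conjunct2)
    finally have "l *\<^sub>R e l = m *\<^sub>R e l" unfolding lm(3) .
    moreover have "e l \<noteq> 0" using e[OF lm(1)] by (rule conjunct1)
    ultimately show "l = m" by (rule scaleR_right_imp_eq[rotated])
  qed
  have "e l \<bullet> e m = 0" if "l \<in> ?E" "m \<in> ?E" "l \<noteq> m" for l m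
  proof -
    have "m * (e l \<bullet> e m) = l * (e l \<bullet> e m)"
      using symmetric_inner_swap[OF sym, of "e l" "e m"] e[OF that(1)] e[OF that(2)]
      by (simp add: inner_commute)
    then show ?thesis using that by auto
  qed
  then have "pairwise orthogonal (e ` ?E)"
    by (auto simp: pairwise_def orthogonal_def)
  then have "finite (e ` ?E)" by (rule pairwise_orthogonal_imp_finite)
  then show ?thesis using inj by (rule finite_imageD)
qed

lemma lambda_max_eq_rayleigh_max:
  fixes J :: "real^'n^'n"
  assumes sym: "transpose J = J"
  obtains x where "norm x = 1" "x \<bullet> (J *v x) = lambda_max J"
    "\<And>y. y \<bullet> (J *v y) \<le> lambda_max J * (y \<bullet> y)"
proof -
  obtain x where x: "norm x = 1" "J *v x = (x \<bullet> (J *v x)) *\<^sub>R x"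
    "\<And>y. y \<bullet> (J *v y) \<le> (x \<bullet> (J *v x)) * (y \<bullet> y)"
    using symmetric_top_eigenvector[OF sym] by blast
  have "lambda_max J = x \<bullet> (J *v x)"
    unfolding lambda_max_def
  proof (rule Max_eqI[OF symmetric_finite_eigenvalues[OF sym]])
    fix l assume "l \<in> {l. \<exists>x. x \<noteq> 0 \<and> J *v x = l *\<^sub>R x}"
    then obtain y where "y \<noteq> 0" "J *v y = l *\<^sub>R y" by auto
    then show "l \<le> x \<bullet> (J *v x)" using x(3)[of y] by simp
  next
    have "x \<noteq> 0" using x(1) by auto
    then show "x \<bullet> (J *v x) \<in> {l. \<exists>x. x \<noteq> 0 \<and> J *v x = l *\<^sub>R x}" using x(2) by auto
  qed
  with x show thesis by (intro that[of x]) simp_all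
qed

lemma rayleigh_le_lambda_max:
  fixes J :: "real^'n^'n"
  assumes "transpose J = J"
  shows "y \<bullet> (J *v y) \<le> lambda_max J * (y \<bullet> y)"
  using lambda_max_eq_rayleigh_max[OF assms] by metis

text \<open>
  For \<open>Y = outer u\<close> this is the bound on the Rayleigh quotient of \<open>u\<close>, and both sides are additive
  in \<open>Y\<close>.
\<close>
lemma inner_psd_le_lambda_max:
  fixes J Y :: "real^'n^'n"
  assumes "psd Y" and J: "transpose J = J"
  shows "Y \<bullet> J \<le> lambda_max J * trace Y"
  using assms(1)
proof (induction rule: psd_induct)
  case zero
  then show ?case by (simp add: trace_def)
next
  case (outer Y u)
  then show ?case
    using rayleigh_le_lambda_max[OF J, of u]
    by (simp add: inner_add_left trace_add trace_outer distrib_left inner_commute[of "outer u"]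
        inner_outer)
qed

text \<open>
  As a maximum of the functionals \<open>A \<mapsto> \<langle>A, outer x\<rangle>\<close> over unit vectors \<open>x\<close>, each of norm one, the
  largest eigenvalue is Lipschitz.  Continuity, and with it measurability, follows.
\<close>
lemma lambda_max_diff_le:
  fixes A B :: "real^'n^'n"
  assumes A: "transpose A = A" and B: "transpose B = B"
  shows "\<bar>lambda_max A - lambda_max B\<bar> \<le> norm (A - B)"
proof -
  have "lambda_max A \<le> lambda_max B + norm (A - B)"
    if A: "transpose A = A" and B: "transpose B = B" for A B :: "real^'n^'n"
  proof -
    obtain x where x: "norm x = 1" "x \<bullet> (A *v x) = lambda_max A"
      using lambda_max_eq_rayleigh_max[OF A] by metis
    have "lambda_max A = x \<bullet> (B *v x) + (A - B) \<bullet> outer x"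
      by (simp add: inner_outer matrix_vector_mult_diff_rdistrib inner_diff_right x(2))
    also have "(A - B) \<bullet> outer x \<le> norm (A - B) * norm (outer x)" by (rule norm_cauchy_schwarz)
    also have "\<dots> = norm (A - B)" by (simp add: norm_outer x(1))
    also have "x \<bullet> (B *v x) \<le> lambda_max B"
      using rayleigh_le_lambda_max[OF B, of x] x(1) by (simp flip: power2_norm_eq_inner)
    finally show ?thesis by simp
  qed
  from this[OF A B] this[OF B A] show ?thesis by (simp add: norm_minus_commute abs_le_iff)
qed

lemma continuous_on_lambda_max:
  "continuous_on {A :: real^'n^'n. transpose A = A} lambda_max"
proof (rule continuous_onI)
  fix A :: "real^'n^'n" and e :: real
  assume "A \<in> {A. transpose A = A}" "e > 0"
  then show "\<exists>d>0. \<forall>B\<in>{A. transpose A = A}. dist B A < d \<longrightarrow> dist (lambda_max B) (lambda_max A) \<le> e"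
    using lambda_max_diff_le by (intro exI[of _ e]) (force simp: dist_norm)
qed

section \<open>Adjoint, gradient and curvature\<close>

lemma linear_on_sym_0: "linear_on_sym B \<Longrightarrow> B 0 = 0"
  unfolding linear_on_sym_def by (metis scaleR_zero_left transpose_zero)

lemma adj_sym_eqI:
  assumes "transpose J = J" "\<And>X. transpose X = X \<Longrightarrow> J \<bullet> X = y \<bullet> B X"
  shows "adj_sym B y = J"
  unfolding adj_sym_def
proof (rule the_equality)
  fix J' assume J': "transpose J' = J' \<and> (\<forall>X. transpose X = X \<longrightarrow> J' \<bullet> X = y \<bullet> B X)"
  have "transpose (J' - J) = J' - J" using J' assms(1) by (simp add: transpose_diff)
  then have "(J' - J) \<bullet> (J' - J) = 0" using J' assms(2)[of "J' - J"] by (simp add: inner_diff_left)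
  then show "J' = J" by simp
qed (use assms in auto)

text \<open>
  Precomposing with the symmetrization \<open>S\<close> extends the functional \<open>X \<mapsto> y \<bullet> B X\<close> linearly to all
  matrices.  The extension is represented by some matrix, which is symmetric because the extension
  does not distinguish \<open>X\<close> from its transpose.
\<close>
lemma
  fixes B :: "real^'n^'n \<Rightarrow> real^'d"
  assumes B: "linear_on_sym B"
  shows transpose_adj_sym: "transpose (adj_sym B y) = adj_sym B y"
    and inner_adj_sym: "transpose X = X \<Longrightarrow> adj_sym B y \<bullet> X = y \<bullet> B X"
proof -
  define S where "S X = (1/2) *\<^sub>R (X + transpose X)" for X :: "real^'n^'n"
  have S: "transpose (S X) = S X" "S (X + Y) = S X + S Y" "S (c *\<^sub>R X) = c *\<^sub>R S X" for X Y c
    by (simp_all add: S_def transpose_scaleR transpose_add add.commute scaleR_right_distrib)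
  have S_sym: "S X = X" if "transpose X = X" for X
    unfolding S_def that by (simp flip: scaleR_2)
  define L where "L X = y \<bullet> B (S X)" for X
  have "linear L"
    using B S unfolding linear_on_sym_def
    by (intro linearI) (auto simp: L_def inner_add_right)
  then have J: "X \<bullet> adjoint L 1 = y \<bullet> B (S X)" for X
    using adjoint_works[of L X 1] by (simp add: L_def)
  have "X \<bullet> transpose (adjoint L 1) = X \<bullet> adjoint L 1" for X
  proof -
    have "S (transpose X) = S X" by (simp add: S_def add.commute)
    then show ?thesis using inner_transpose_transpose[of "transpose X" "adjoint L 1"] J
      by simp
  qed
  then have sym: "transpose (adjoint L 1) = adjoint L 1" using vector_eq_ldot by blast
  have inner: "adjoint L 1 \<bullet> X = y \<bullet> B X" if "transpose X = X" for X
    using J[of X] S_sym[OF that] by (simp add: inner_commute)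
  have "adj_sym B y = adjoint L 1" using sym inner by (rule adj_sym_eqI)
  then show "transpose (adj_sym B y) = adj_sym B y"
    and "transpose X = X \<Longrightarrow> adj_sym B y \<bullet> X = y \<bullet> B X"
    using sym inner by simp_all
qed

lemma linear_adj_sym:
  assumes B: "linear_on_sym B"
  shows "linear (adj_sym B)"
  by (intro linearI adj_sym_eqI)
    (simp_all add: transpose_add transpose_scaleR transpose_adj_sym[OF B] inner_adj_sym[OF B]
      inner_add_left)

lemma GDERIV_grad:
  assumes "g differentiable (at v)"
  shows "GDERIV g v :> grad g v"
proof -
  obtain g' where g': "(g has_derivative g') (at v)" using assms by (auto simp: differentiable_def)
  then have "linear g'" by (rule has_derivative_linear)
  then have "g' = (\<lambda>h. h \<bullet> adjoint g' 1)" using adjoint_works[of g' _ 1] by auto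
  then have D: "GDERIV g v :> adjoint g' 1" using g' by (simp add: gderiv_def)
  have "D' = adjoint g' 1" if "GDERIV g v :> D'" for D'
  proof -
    from that D have "(\<lambda>h. h \<bullet> D') = (\<lambda>h. h \<bullet> adjoint g' 1)"
      unfolding gderiv_def by (intro has_derivative_unique)
    then show ?thesis by (metis vector_eq_ldot)
  qed
  with D show ?thesis unfolding grad_def by (rule theI[where P = "\<lambda>D. GDERIV g v :> D"])
qed

text \<open>
  Restriction to the line through \<open>x\<close> and \<open>y\<close> reduces this to one variable.
\<close>
lemma concave_le_tangent:
  fixes g :: "real^'d \<Rightarrow> real"
  assumes conc: "concave_on UNIV g" and diff: "g differentiable (at x)"
  shows "g y \<le> g x + (y - x) \<bullet> grad g x"
proof -
  define \<phi> where "\<phi> t = - g (x + t *\<^sub>R (y - x))" for t :: real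
  have "convex_on UNIV \<phi>"
  proof (rule convex_onI)
    fix t a b :: real assume t: "0 < t" "t < 1"
    have "x + ((1 - t) *\<^sub>R a + t *\<^sub>R b) *\<^sub>R (y - x)
        = (1 - t) *\<^sub>R (x + a *\<^sub>R (y - x)) + t *\<^sub>R (x + b *\<^sub>R (y - x))"
      by (simp add: algebra_simps)
    then show "\<phi> ((1 - t) *\<^sub>R a + t *\<^sub>R b) \<le> (1 - t) * \<phi> a + t * \<phi> b"
      using convex_onD[of UNIV "\<lambda>x. - g x" t "x + a *\<^sub>R (y - x)" "x + b *\<^sub>R (y - x)"] conc t
      by (simp add: \<phi>_def concave_on_def)
  qed simp
  moreover have "(\<phi> has_field_derivative - ((y - x) \<bullet> grad g x)) (at 0)"
  proof -
    have "(g has_derivative (\<lambda>h. h \<bullet> grad g x)) (at (x + 0 *\<^sub>R (y - x)))"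
      using GDERIV_grad[OF diff] by (simp add: gderiv_def)
    moreover have "((\<lambda>t. x + t *\<^sub>R (y - x)) has_derivative (\<lambda>t. t *\<^sub>R (y - x))) (at (0::real))"
      by (auto intro!: derivative_eq_intros)
    ultimately have "((\<lambda>t. g (x + t *\<^sub>R (y - x))) has_derivative (\<lambda>t. (t *\<^sub>R (y - x)) \<bullet> grad g x)) (at 0)"
      by (rule has_derivative_compose[rotated])
    then have "(\<phi> has_derivative (\<lambda>t. - ((t *\<^sub>R (y - x)) \<bullet> grad g x))) (at 0)"
      unfolding \<phi>_def by (rule has_derivative_minus)
    then show ?thesis by (rule has_derivative_imp_has_field_derivative) simp
  qed
  ultimately have "\<phi> 1 - \<phi> 0 \<ge> - ((y - x) \<bullet> grad g x) * (1 - 0)"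
    by (intro convex_on_imp_above_tangent[of UNIV]) auto
  then show ?thesis by (simp add: \<phi>_def)
qed

lemma step_size_bounds: "0 < step_size t" "step_size t \<le> 1"
  by (simp_all add: step_size_def)

lemma feasible_imp_symmetric: "X \<in> feasible P \<Longrightarrow> transpose X = X"
  by (simp add: feasible_def psd_def)

lemma convex_feasible:
  assumes "X \<in> feasible P" "Y \<in> feasible P" "0 \<le> c" "c \<le> 1"
  shows "(1 - c) *\<^sub>R X + c *\<^sub>R Y \<in> feasible P"
proof -
  have "trace ((1 - c) *\<^sub>R X + c *\<^sub>R Y) = (1 - c) * trace X + c * trace Y"
    by (simp add: trace_add trace_scaleR)
  also have "\<dots> \<le> (1 - c) * bnd P + c * bnd P"
    using assms by (intro add_mono mult_left_mono) (auto simp: feasible_def)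
  also have "\<dots> = bnd P" by (simp add: algebra_simps)
  finally show ?thesis
    using assms by (auto simp: feasible_def intro!: psd_add psd_scaleR)
qed

lemma norm_power_step: "norm x = 1 \<Longrightarrow> norm (power_step J \<sigma> x) = 1"
  by (simp add: power_step_def Let_def)

lemma norm_LMO: "norm x = 1 \<Longrightarrow> norm (LMO P t v x) = 1"
proof -
  assume x: "norm x = 1"
  have "norm ((power_step J \<sigma> ^^ k) x) = 1" for k :: nat and J \<sigma>
    by (induction k) (simp_all add: x norm_power_step)
  then show ?thesis by (simp add: LMO_def)
qed

lemma norm_fw_w: "(\<And>t. norm (\<xi> t) = 1) \<Longrightarrow> norm (fw_w P \<xi> t) = 1"
  by (simp add: fw_w_def norm_LMO)

text \<open>
  The defining recursion spells out the call of \<open>LMO\<close>; in terms of \<open>fw_w\<close> it has the shape of the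
  recursion for \<open>fw_X\<close>.
\<close>
lemma fw_v_Suc:
  "fw_v P \<xi> (Suc t) = (1 - step_size t) *\<^sub>R fw_v P \<xi> t
     + step_size t *\<^sub>R fw_q P (fw_v P \<xi> t) (fw_w P \<xi> t)"
  by (simp add: fw_w_def)

lemma curvature_step:
  assumes curv: "curvature P \<le> ereal C"
    and X: "X \<in> feasible P" and H: "H \<in> feasible P" and \<gamma>: "0 < \<gamma>" "\<gamma> \<le> 1"
  shows "objective P (X + \<gamma> *\<^sub>R (H - X))
    \<ge> objective P X + \<gamma> * ((H - X) \<bullet> Jmat P (lin P X)) - \<gamma>\<^sup>2 * (C / 2)"
proof -
  define Y where "Y = X + \<gamma> *\<^sub>R (H - X)"
  define r where "r = objective P Y - objective P X - (Y - X) \<bullet> Jmat P (lin P X)"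
  have "ereal (- (2 / \<gamma>\<^sup>2) * r) \<le> curvature P"
    unfolding curvature_def r_def Y_def
    by (rule SUP_upper2[of "(X, H, \<gamma>)"]) (use X H \<gamma> in \<open>simp_all add: Let_def\<close>)
  then have "- (2 / \<gamma>\<^sup>2) * r \<le> C" using curv by (metis order_trans ereal_less_eq(3))
  then have "\<gamma>\<^sup>2 / 2 * (- (2 / \<gamma>\<^sup>2) * r) \<le> \<gamma>\<^sup>2 / 2 * C" by (intro mult_left_mono) simp_all
  then have "- r \<le> \<gamma>\<^sup>2 * (C / 2)" using \<gamma> by simp
  then show ?thesis by (simp add: r_def Y_def)
qed

section \<open>Convergence for arbitrary start vectors\<close>

locale fw_problem =
  fixes P :: "('n::finite, 'd::finite) fw_input"
  assumes concave: "concave_on UNIV (obj P)"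
    and differentiable: "\<And>v. obj P differentiable (at v)"
    and continuous_grad: "continuous_on UNIV (grad (obj P))"
    and linear: "linear_on_sym (lin P)"
    and bnd_pos: "0 < bnd P"
    and start_feasible: "start P \<in> feasible P"
begin

lemma transpose_Jmat: "transpose (Jmat P v) = Jmat P v"
  unfolding Jmat_def by (rule transpose_adj_sym[OF linear])

lemma inner_Jmat: "transpose X = X \<Longrightarrow> X \<bullet> Jmat P v = lin P X \<bullet> grad (obj P) v"
  unfolding Jmat_def using inner_adj_sym[OF linear] by (metis inner_commute)

lemma continuous_on_Jmat: "continuous_on UNIV (Jmat P)"
proof -
  have "continuous_on UNIV (adj_sym (lin P))"
    using linear_adj_sym[OF linear] by (simp add: linear_continuous_on linear_conv_bounded_linear)
  then show ?thesis
    unfolding Jmat_def using continuous_grad by (rule continuous_on_compose2) simp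
qed

lemma lin_add: "transpose X = X \<Longrightarrow> transpose Y = Y \<Longrightarrow> lin P (X + Y) = lin P X + lin P Y"
  and lin_scaleR: "transpose X = X \<Longrightarrow> lin P (c *\<^sub>R X) = c *\<^sub>R lin P X"
  using linear unfolding linear_on_sym_def by blast+

lemma zero_feasible: "0 \<in> feasible P"
  using bnd_pos by (simp add: feasible_def psd_0 trace_def)

lemma objective_le_linearization:
  assumes X: "X \<in> feasible P" and Y: "Y \<in> feasible P"
  shows "objective P Y \<le> objective P X + (Y - X) \<bullet> Jmat P (lin P X)"
proof -
  have "(Y - X) \<bullet> Jmat P (lin P X) = (lin P Y - lin P X) \<bullet> grad (obj P) (lin P X)"
    using inner_Jmat X Y by (simp add: inner_diff_left feasible_imp_symmetric)
  then show ?thesis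
    using concave_le_tangent[OF concave differentiable] by (simp add: objective_def)
qed

text \<open>
  The right-hand side is the maximum of the linear functional over the feasible set, attained at
  a multiple of \<open>outer w\<close> for a top eigenvector \<open>w\<close>, or at \<open>0\<close> if the largest eigenvalue of \<open>J\<close> is
  negative.
\<close>
lemma inner_feasible_le:
  assumes Y: "Y \<in> feasible P" and J: "transpose J = J"
  shows "Y \<bullet> J \<le> bnd P * max 0 (lambda_max J)"
proof -
  have Y': "psd Y" "0 \<le> trace Y" "trace Y \<le> bnd P"
    using Y trace_psd_nonneg by (auto simp: feasible_def)
  have "Y \<bullet> J \<le> lambda_max J * trace Y" by (rule inner_psd_le_lambda_max[OF Y'(1) J])
  also have "\<dots> \<le> max 0 (lambda_max J) * trace Y" using Y'(2) by (intro mult_right_mono) auto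
  also have "\<dots> \<le> max 0 (lambda_max J) * bnd P" using Y'(3) by (intro mult_left_mono) auto
  finally show ?thesis by (simp add: mult.commute)
qed

text \<open>
  The linearization at the feasible point \<open>0\<close> is an upper bound for the concave objective.
\<close>
lemma objective_bounded_above: "\<exists>K. \<forall>Y\<in>feasible P. objective P Y \<le> K"
proof -
  define J where "J = Jmat P (lin P 0)"
  have "objective P Y \<le> objective P 0 + bnd P * max 0 (lambda_max J)" if "Y \<in> feasible P" for Y
    using objective_le_linearization[OF zero_feasible that]
      inner_feasible_le[OF that transpose_Jmat, of "lin P 0"] by (simp add: J_def)
  then show ?thesis by blast
qed

lemma fw_H_feasible: "norm w = 1 \<Longrightarrow> fw_H P v w \<in> feasible P"
  using zero_feasible bnd_pos
  by (auto simp: fw_H_def feasible_def psd_scaleR psd_outer trace_scaleR trace_outer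
      simp flip: power2_norm_eq_inner)

lemma lin_fw_H: "lin P (fw_H P v w) = fw_q P v w"
  by (simp add: fw_H_def fw_q_def linear_on_sym_0[OF linear])

text \<open>
  So the value that the stopping test compares with \<open>\<epsilon>\<close> is that of the linearized objective at the
  point towards which the algorithm moves.
\<close>
lemma inner_fw_q:
  "fw_q P v w \<bullet> grad (obj P) v = (if ascent P v w then bnd P * (w \<bullet> (Jmat P v *v w)) else 0)"
proof -
  have "(bnd P *\<^sub>R outer w) \<bullet> Jmat P v = bnd P * (w \<bullet> (Jmat P v *v w))"
    using inner_outer[of "Jmat P v" w] by (simp add: inner_commute)
  then show ?thesis
    by (simp add: fw_q_def transpose_scaleR transpose_outer flip: inner_Jmat)
qed

lemma fw_iterates:
  assumes "\<And>t. norm (\<xi> t) = 1"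
  shows "fw_X P \<xi> t \<in> feasible P \<and> fw_v P \<xi> t = lin P (fw_X P \<xi> t)"
proof (induction t)
  case 0
  then show ?case by (simp add: start_feasible)
next
  case (Suc t)
  define H where "H = fw_H P (fw_v P \<xi> t) (fw_w P \<xi> t)"
  have H: "H \<in> feasible P" unfolding H_def by (intro fw_H_feasible norm_fw_w assms)
  have X: "fw_X P \<xi> t \<in> feasible P" using Suc by simp
  have "fw_X P \<xi> (Suc t) \<in> feasible P"
    using convex_feasible[OF X H] step_size_bounds[of t] by (simp add: H_def)
  moreover have "fw_v P \<xi> (Suc t) = (1 - step_size t) *\<^sub>R lin P (fw_X P \<xi> t) + step_size t *\<^sub>R lin P H"
    using Suc by (simp add: H_def lin_fw_H fw_v_Suc del: fw_v.simps)
  then have "fw_v P \<xi> (Suc t) = lin P (fw_X P \<xi> (Suc t))"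
    using feasible_imp_symmetric[OF X] feasible_imp_symmetric[OF H]
    by (simp add: lin_add lin_scaleR transpose_scaleR flip: H_def)
  ultimately show ?case by blast
qed

text \<open>
  A failing stopping test says that the linearized gain exceeds \<open>\<epsilon>\<close>, for whatever direction was
  found.  For this reason the number of iterations is bounded surely and not only with high
  probability.
\<close>
lemma fw_progress:
  assumes unit: "\<And>t. norm (\<xi> t) = 1" and curv: "curvature P \<le> ereal C"
    and not_stop: "\<not> fw_stop P \<xi> t"
  shows "objective P (fw_X P \<xi> (Suc t))
    \<ge> objective P (fw_X P \<xi> t) + (step_size t * eps P - (step_size t)\<^sup>2 * (C / 2))"
proof -
  define X H \<gamma> where "X = fw_X P \<xi> t" and "H = fw_H P (fw_v P \<xi> t) (fw_w P \<xi> t)" and "\<gamma> = step_size t"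
  note defs = X_def H_def \<gamma>_def
  have X: "X \<in> feasible P" and v: "fw_v P \<xi> t = lin P X"
    using fw_iterates[OF unit] by (simp_all add: defs)
  have H: "H \<in> feasible P" unfolding defs by (intro fw_H_feasible norm_fw_w unit)
  have "eps P < (lin P H - lin P X) \<bullet> grad (obj P) (lin P X)"
    using not_stop unfolding v[symmetric] by (simp add: fw_stop_def defs lin_fw_H)
  also have "\<dots> = (H - X) \<bullet> Jmat P (lin P X)"
    using X H by (simp add: inner_diff_left inner_Jmat feasible_imp_symmetric)
  finally have "\<gamma> * eps P \<le> \<gamma> * ((H - X) \<bullet> Jmat P (lin P X))"
    using step_size_bounds[of t] by (intro mult_left_mono) (simp_all add: defs)
  moreover have next_iterate: "fw_X P \<xi> (Suc t) = X + \<gamma> *\<^sub>R (H - X)"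
    by (simp add: defs algebra_simps)
  moreover have "0 < \<gamma>" "\<gamma> \<le> 1" using step_size_bounds[of t] by (simp_all add: defs(3))
  then have "objective P (X + \<gamma> *\<^sub>R (H - X))
      \<ge> objective P X + \<gamma> * ((H - X) \<bullet> Jmat P (lin P X)) - \<gamma>\<^sup>2 * (C / 2)"
    by (rule curvature_step[OF curv X H])
  ultimately have "objective P (fw_X P \<xi> (Suc t)) \<ge> objective P X + (\<gamma> * eps P - \<gamma>\<^sup>2 * (C / 2))"
    unfolding next_iterate by linarith
  then show ?thesis by (simp only: defs)
qed

text \<open>
  The guaranteed gains \<open>s t\<close> are summed explicitly: \<open>\<gamma>\<^sub>t = 2/(t+2)\<close> is twice a term of the harmonic series,
  and \<open>\<gamma>\<^sub>t\<^sup>2\<close> is dominated by the telescoping difference \<open>4/(t+1) - 4/(t+2)\<close>.  Their partial sums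
  therefore pass the gap between the start value and an upper bound of the objective.
\<close>
lemma stopping_time_bounded:
  assumes curv: "curvature P \<le> ereal C" and eps: "0 < eps P"
  shows "\<exists>N. \<forall>\<xi>. (\<forall>t. norm (\<xi> t) = 1) \<longrightarrow> (\<exists>t\<le>N. fw_stop P \<xi> t)"
proof -
  obtain K where K: "\<And>Y. Y \<in> feasible P \<Longrightarrow> objective P Y \<le> K"
    using objective_bounded_above by blast
  define s where "s t = step_size t * eps P - (step_size t)\<^sup>2 * (C / 2)" for t
  have sq: "(step_size t)\<^sup>2 \<le> 4 / (real t + 1) - 4 / (real t + 2)" for t
    by (simp add: step_size_def power2_eq_square divide_simps)
  have "(\<Sum>t<N. s t) \<ge> 2 * eps P * (harm (Suc N) - 1) - 2 * \<bar>C\<bar>" for N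
  proof -
    have "2 * eps P * (harm (Suc N) - 1) - \<bar>C\<bar> / 2 * (4 - 4 / (real N + 1)) \<le> (\<Sum>t<N. s t)"
    proof (induction N)
      case 0
      then show ?case by (simp add: harm_def)
    next
      case (Suc N)
      have "2 * eps P * (harm (Suc (Suc N)) - 1)
          = 2 * eps P * (harm (Suc N) - 1) + step_size N * eps P"
        by (simp add: harm_Suc[of "Suc N"] step_size_def field_simps)
      moreover have "\<bar>C\<bar> / 2 * (4 - 4 / (real (Suc N) + 1))
          = \<bar>C\<bar> / 2 * (4 - 4 / (real N + 1)) + (4 / (real N + 1) - 4 / (real N + 2)) * (\<bar>C\<bar> / 2)"
        by (simp add: algebra_simps)
      moreover have "(step_size N)\<^sup>2 * (C / 2) \<le> (step_size N)\<^sup>2 * (\<bar>C\<bar> / 2)"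
        by (intro mult_left_mono) auto
      moreover have "(step_size N)\<^sup>2 * (\<bar>C\<bar> / 2) \<le> (4 / (real N + 1) - 4 / (real N + 2)) * (\<bar>C\<bar> / 2)"
        by (intro mult_right_mono sq) auto
      moreover have "(\<Sum>t<Suc N. s t) = (\<Sum>t<N. s t) + (step_size N * eps P - (step_size N)\<^sup>2 * (C / 2))"
        by (simp add: s_def)
      ultimately show ?case using Suc by linarith
    qed
    moreover have "\<bar>C\<bar> / 2 * (4 - 4 / (real N + 1)) \<le> \<bar>C\<bar> / 2 * 4"
      by (intro mult_left_mono) auto
    ultimately show ?thesis by linarith
  qed
  moreover have "\<exists>N. 2 * eps P * (harm (Suc N) - 1) - 2 * \<bar>C\<bar> > K - objective P (start P)"
  proof -
    define b where "b = (K - objective P (start P) + 2 * \<bar>C\<bar>) / (2 * eps P) + 1"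
    have "eventually (\<lambda>N. (harm N :: real) > b) at_top"
      using harm_at_top by (simp add: filterlim_at_top_dense)
    then obtain N0 where "\<And>N. N \<ge> N0 \<Longrightarrow> (harm N :: real) > b"
      by (auto simp: eventually_at_top_linorder)
    then have "harm (Suc N0) > b" by simp
    then show ?thesis using eps by (intro exI[of _ N0]) (simp add: b_def field_simps)
  qed
  ultimately obtain N where N: "(\<Sum>t<N. s t) > K - objective P (start P)"
    by (meson less_le_trans)
  have "\<exists>t\<le>N. fw_stop P \<xi> t" if unit: "\<And>t. norm (\<xi> t) = 1" for \<xi>
  proof (rule ccontr)
    assume none: "\<not> (\<exists>t\<le>N. fw_stop P \<xi> t)"
    have "m \<le> N \<Longrightarrow> objective P (fw_X P \<xi> m) \<ge> objective P (start P) + (\<Sum>t<m. s t)" for m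
    proof (induction m)
      case (Suc m)
      then have "\<not> fw_stop P \<xi> m" using none by auto
      from fw_progress[OF unit curv this] Suc show ?case by (simp add: s_def)
    qed simp
    from this[of N] K[of "fw_X P \<xi> N"] fw_iterates[of \<xi> N, OF unit] N show False by simp
  qed
  then show ?thesis by blast
qed

text \<open>
  If \<open>w\<close> is no ascent direction, the comparison point is \<open>0\<close> and accuracy bounds the largest
  eigenvalue of \<open>J\<close>, scaled by \<open>\<alpha>\<close>, by \<open>\<delta>\<close>; in both cases the comparison point is within \<open>\<delta>\<close> of
  maximizing the linearized objective.
\<close>
lemma stop_imp_eps_optimal:
  assumes unit: "\<And>t. norm (\<xi> t) = 1" and stop: "fw_stop P \<xi> t" and \<delta>: "0 \<le> \<delta>"
    and acc: "lmo_accurate P \<delta> (fw_v P \<xi> t) (fw_w P \<xi> t)"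
  shows "eps_optimal P (eps P + \<delta>) (fw_X P \<xi> t)"
proof -
  define X w v where "X = fw_X P \<xi> t" and "w = fw_w P \<xi> t" and "v = fw_v P \<xi> t"
  note defs = X_def w_def v_def
  have X: "X \<in> feasible P" and v: "v = lin P X" using fw_iterates[OF unit] by (simp_all add: defs)
  have w: "norm w = 1" unfolding defs by (intro norm_fw_w unit)
  define J where "J = Jmat P v"
  have J: "transpose J = J" unfolding J_def by (rule transpose_Jmat)
  have q: "(fw_q P v w - v) \<bullet> grad (obj P) v \<le> eps P" using stop by (simp add: fw_stop_def defs)
  have acc': "bnd P * lambda_max J \<le> bnd P * (w \<bullet> (J *v w)) + \<delta>"
    using acc by (simp add: lmo_accurate_def J_def defs)
  have best_direction: "bnd P * max 0 (lambda_max J) \<le> fw_q P v w \<bullet> grad (obj P) v + \<delta>"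
  proof (cases "ascent P v w")
    case True
    then have "0 \<le> w \<bullet> (J *v w)" by (simp add: ascent_def J_def)
    also have "\<dots> \<le> lambda_max J"
      using rayleigh_le_lambda_max[OF J, of w] w by (simp flip: power2_norm_eq_inner)
    finally show ?thesis using acc' True by (simp add: inner_fw_q J_def)
  next
    case False
    then have "bnd P * (w \<bullet> (J *v w)) \<le> 0"
      using bnd_pos by (intro mult_nonneg_nonpos) (auto simp: ascent_def J_def)
    then show ?thesis using acc' False \<delta> by (simp add: inner_fw_q max_def)
  qed
  have "objective P Y \<le> objective P X + (eps P + \<delta>)" if Y: "Y \<in> feasible P" for Y
  proof -
    have "X \<bullet> J = v \<bullet> grad (obj P) v"
      using inner_Jmat[OF feasible_imp_symmetric[OF X], of v] by (simp add: J_def v)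
    then have "(Y - X) \<bullet> J \<le> eps P + \<delta>"
      using inner_feasible_le[OF Y J] best_direction q by (simp add: inner_diff_left)
    then show ?thesis using objective_le_linearization[OF X Y] by (simp add: J_def v)
  qed
  then have "(SUP Y\<in>feasible P. objective P Y) \<le> objective P X + (eps P + \<delta>)"
    using X by (intro cSUP_least) auto
  then show ?thesis using X by (simp add: eps_optimal_def flip: defs)
qed

end

section \<open>Measurability of the iterates\<close>

lemma borel_measurable_matrix_vector_mult:
  fixes A :: "'a \<Rightarrow> real^'n::finite^'m::finite"
  assumes "A \<in> borel_measurable M" "x \<in> borel_measurable M"
  shows "(\<lambda>\<omega>. A \<omega> *v x \<omega>) \<in> borel_measurable M"
  using assms
proof (rule borel_measurable_continuous_Pair)
  show "continuous_on UNIV (\<lambda>p :: (real^'n^'m) \<times> (real^'n). fst p *v snd p)"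
    unfolding matrix_vector_mult_def by (intro continuous_intros)
qed

lemma borel_measurable_outer:
  assumes "w \<in> borel_measurable M"
  shows "(\<lambda>\<omega>. outer (w \<omega> :: real^'n::finite)) \<in> borel_measurable M"
proof -
  have "continuous_on UNIV (outer :: real^'n \<Rightarrow> _)"
    unfolding outer_def by (intro continuous_intros)
  then show ?thesis using assms by (rule borel_measurable_continuous_on)
qed

lemma measurable_power_step:
  assumes [measurable]: "J \<in> borel_measurable M" "w \<in> borel_measurable M"
  shows "(\<lambda>\<omega>. power_step (J \<omega>) \<sigma> (w \<omega>)) \<in> borel_measurable M"
proof -
  note borel_measurable_matrix_vector_mult[measurable]
  show ?thesis unfolding power_step_def Let_def by measurable
qed

context fw_problem
begin

lemma measurable_Jmat [measurable]: "Jmat P \<in> borel_measurable borel"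
  by (rule borel_measurable_continuous_onI[OF continuous_on_Jmat])

lemma measurable_grad [measurable]: "grad (obj P) \<in> borel_measurable borel"
  by (rule borel_measurable_continuous_onI[OF continuous_grad])

lemma measurable_lambda_max_Jmat [measurable]:
  "(\<lambda>v. lambda_max (Jmat P v)) \<in> borel_measurable borel"
  by (intro borel_measurable_continuous_onI continuous_on_compose2[OF continuous_on_lambda_max]
      continuous_on_Jmat) (auto simp: transpose_Jmat)

lemma measurable_LMO:
  assumes [measurable]: "v \<in> borel_measurable M" "x \<in> borel_measurable M"
  shows "(\<lambda>\<omega>. LMO P t (v \<omega>) (x \<omega>)) \<in> borel_measurable M"
proof -
  have "(\<lambda>\<omega>. (power_step (Jmat P (v \<omega>)) (shift P t) ^^ k) (x \<omega>)) \<in> borel_measurable M" for k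
  proof (induction k)
    case (Suc k)
    show ?case unfolding funpow.simps comp_def by (rule measurable_power_step[OF _ Suc]) measurable
  qed simp
  then show ?thesis unfolding LMO_def .
qed

lemma measurable_lmo_accurate:
  assumes [measurable]: "v \<in> borel_measurable M" "w \<in> borel_measurable M"
  shows "Measurable.pred M (\<lambda>\<omega>. lmo_accurate P \<delta> (v \<omega>) (w \<omega>))"
proof -
  note borel_measurable_matrix_vector_mult[measurable]
  show ?thesis unfolding lmo_accurate_def by measurable
qed

lemma measurable_ascent:
  assumes [measurable]: "v \<in> borel_measurable M" "w \<in> borel_measurable M"
  shows "Measurable.pred M (\<lambda>\<omega>. ascent P (v \<omega>) (w \<omega>))"
proof -
  note borel_measurable_matrix_vector_mult[measurable]
  show ?thesis unfolding ascent_def by measurable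
qed

lemma measurable_fw_H:
  assumes [measurable]: "v \<in> borel_measurable M" "w \<in> borel_measurable M"
  shows "(\<lambda>\<omega>. fw_H P (v \<omega>) (w \<omega>)) \<in> borel_measurable M"
proof -
  note borel_measurable_outer[measurable] measurable_ascent[measurable]
  show ?thesis unfolding fw_H_def by measurable
qed

lemma measurable_fw_dir:
  assumes [measurable]: "v \<in> borel_measurable M" "w \<in> borel_measurable M"
  shows "(\<lambda>\<omega>. fw_dir P (v \<omega>) (w \<omega>)) \<in> borel_measurable M"
proof -
  note measurable_ascent[measurable]
  show ?thesis unfolding fw_dir_def by measurable
qed

lemma transpose_fw_H: "transpose (fw_H P v w) = fw_H P v w"
  by (simp add: fw_H_def transpose_scaleR transpose_outer transpose_zero)

text \<open>
  The map \<open>B\<close> is arbitrary off the symmetric matrices and need not be measurable there, so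
  it is replaced by a linear map with which it agrees on symmetric matrices.
\<close>
lemma measurable_fw_q:
  assumes [measurable]: "v \<in> borel_measurable M" "w \<in> borel_measurable M"
  shows "(\<lambda>\<omega>. fw_q P (v \<omega>) (w \<omega>)) \<in> borel_measurable M"
proof -
  note measurable_fw_H[measurable]
  define h where "h X = (\<chi> i. adj_sym (lin P) (axis i 1) \<bullet> X)" for X
  have q: "fw_q P v w = h (fw_H P v w)" for v w
    by (simp add: h_def vec_eq_iff inner_adj_sym[OF linear transpose_fw_H] lin_fw_H inner_axis')
  have "continuous_on UNIV h" unfolding h_def by (intro continuous_intros)
  then show ?thesis unfolding q using measurable_fw_H[OF assms] by (rule borel_measurable_continuous_on)
qed

text \<open>
  The measure space is left open: it is taken below to be the probability space, one of its
  sub-\<open>\<sigma>\<close>-algebras generated by some of the random inputs, or a product space whose points are the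
  inputs themselves.
\<close>
context
  fixes M :: "'a measure" and \<xi> :: "'a \<Rightarrow> nat \<Rightarrow> real^'n"
  assumes \<xi> [measurable]: "\<And>t. (\<lambda>\<omega>. \<xi> \<omega> t) \<in> borel_measurable M"
begin

lemma measurable_fw_v [measurable]: "(\<lambda>\<omega>. fw_v P (\<xi> \<omega>) t) \<in> borel_measurable M"
proof (induction t)
  case (Suc t)
  note [measurable] = Suc measurable_fw_q measurable_LMO
  show ?case by simp measurable
qed simp

lemma measurable_fw_w [measurable]: "(\<lambda>\<omega>. fw_w P (\<xi> \<omega>) t) \<in> borel_measurable M"
  unfolding fw_w_def by (intro measurable_LMO measurable_fw_v \<xi>)

lemma measurable_fw_T [measurable]: "(\<lambda>\<omega>. fw_T P (\<xi> \<omega>)) \<in> measurable M (count_space UNIV)"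
proof -
  note measurable_fw_q[measurable]
  show ?thesis unfolding fw_T_def fw_stop_def by measurable
qed

lemma measurable_fw_X [measurable]: "(\<lambda>\<omega>. fw_X P (\<xi> \<omega>) t) \<in> borel_measurable M"
proof (induction t)
  case (Suc t)
  note [measurable] = Suc measurable_fw_H
  show ?case by simp measurable
qed simp

lemma measurable_fw_z:
  assumes [measurable]: "z0 \<in> borel_measurable M" "\<And>t. (\<lambda>\<omega>. \<zeta> \<omega> t) \<in> borel_measurable M"
  shows "(\<lambda>\<omega>. fw_z P (z0 \<omega>) (\<xi> \<omega>) (\<zeta> \<omega>) t) \<in> borel_measurable M"
proof (induction t)
  case (Suc t)
  note [measurable] = Suc measurable_fw_dir
  show ?case by simp measurable
qed simp

lemma measurable_fw_accurate:
  "Measurable.pred M (\<lambda>\<omega>. lmo_accurate P \<delta> (fw_v P (\<xi> \<omega>) t) (fw_w P (\<xi> \<omega>) t))"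
  by (intro measurable_lmo_accurate measurable_fw_v measurable_fw_w)

end

end

section \<open>Freezing one of two independent variables\<close>

text \<open>
  Independence of \<open>X\<close> and \<open>Y\<close> is expressed by the product form of their joint law.  This makes sense for
  variables with values in different types, such as the sequence of start vectors on the one hand
  and the initial sample together with the normal numbers on the other.
\<close>
context prob_space
begin

text \<open>
  Fubini's theorem for the product law: the section of \<open>Q\<close> at \<open>X \<omega>\<close> is measured by an independent
  copy of \<open>Y\<close>.
\<close>
lemma
  assumes X: "X \<in> measurable M S" and Y: "Y \<in> measurable M T"
    and product: "distr M (S \<Otimes>\<^sub>M T) (\<lambda>\<omega>. (X \<omega>, Y \<omega>)) = distr M S X \<Otimes>\<^sub>M distr M T Y"
    and Q: "Q \<in> sets (S \<Otimes>\<^sub>M T)"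
  shows measurable_prob_freeze:
      "(\<lambda>\<omega>. prob {\<omega>' \<in> space M. (X \<omega>, Y \<omega>') \<in> Q}) \<in> borel_measurable (vimage_algebra (space M) X S)"
    and prob_freeze:
      "prob {\<omega> \<in> space M. (X \<omega>, Y \<omega>) \<in> Q} = (\<integral>\<omega>. prob {\<omega>' \<in> space M. (X \<omega>, Y \<omega>') \<in> Q} \<partial>M)"
proof -
  interpret DY: prob_space "distr M T Y" using Y by (rule prob_space_distr)
  define h where "h x = emeasure (distr M T Y) (Pair x -` Q)" for x
  have Q': "Q \<in> sets (S \<Otimes>\<^sub>M distr M T Y)" "Q \<in> sets (distr M S X \<Otimes>\<^sub>M distr M T Y)"
    using Q by (simp_all cong: sets_pair_measure_cong)
  have h: "h \<in> borel_measurable S"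
    unfolding h_def by (rule DY.measurable_emeasure_Pair[OF Q'(1)])
  have h_eq: "h (X \<omega>) = ennreal (prob {\<omega>' \<in> space M. (X \<omega>, Y \<omega>') \<in> Q})" for \<omega>
  proof -
    have "Y -` (Pair (X \<omega>) -` Q) \<inter> space M = {\<omega>' \<in> space M. (X \<omega>, Y \<omega>') \<in> Q}" by auto
    then show ?thesis
      unfolding h_def by (subst emeasure_distr[OF Y sets_Pair1[OF Q]]) (simp add: emeasure_eq_measure)
  qed
  have "X \<in> measurable (vimage_algebra (space M) X S) S"
    using X by (intro measurable_vimage_algebra1) (auto dest: measurable_space)
  from measurable_compose[OF this h]
  have "(\<lambda>\<omega>. enn2real (h (X \<omega>))) \<in> borel_measurable (vimage_algebra (space M) X S)"
    by measurable
  then show "(\<lambda>\<omega>. prob {\<omega>' \<in> space M. (X \<omega>, Y \<omega>') \<in> Q})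
      \<in> borel_measurable (vimage_algebra (space M) X S)"
    by (simp add: h_eq)
  have "(\<lambda>\<omega>. enn2real (h (X \<omega>))) \<in> borel_measurable M"
    using measurable_compose[OF X h] by measurable
  then have meas: "(\<lambda>\<omega>. prob {\<omega>' \<in> space M. (X \<omega>, Y \<omega>') \<in> Q}) \<in> borel_measurable M"
    by (simp add: h_eq)
  have XY: "(\<lambda>\<omega>. (X \<omega>, Y \<omega>)) \<in> measurable M (S \<Otimes>\<^sub>M T)" using X Y by measurable
  have "(\<lambda>\<omega>. (X \<omega>, Y \<omega>)) -` Q \<inter> space M = {\<omega> \<in> space M. (X \<omega>, Y \<omega>) \<in> Q}" by auto
  then have "emeasure M {\<omega> \<in> space M. (X \<omega>, Y \<omega>) \<in> Q}
      = emeasure (distr M (S \<Otimes>\<^sub>M T) (\<lambda>\<omega>. (X \<omega>, Y \<omega>))) Q"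
    by (subst emeasure_distr[OF XY Q]) simp
  also have "\<dots> = emeasure (distr M S X \<Otimes>\<^sub>M distr M T Y) Q"
    by (simp add: product)
  also have "\<dots> = (\<integral>\<^sup>+x. h x \<partial>distr M S X)"
    unfolding h_def by (rule DY.emeasure_pair_measure_alt[OF Q'(2)])
  also have "\<dots> = (\<integral>\<^sup>+\<omega>. h (X \<omega>) \<partial>M)" using h by (intro nn_integral_distr[OF X]) simp
  finally have "emeasure M {\<omega> \<in> space M. (X \<omega>, Y \<omega>) \<in> Q}
      = (\<integral>\<^sup>+\<omega>. ennreal (prob {\<omega>' \<in> space M. (X \<omega>, Y \<omega>') \<in> Q}) \<partial>M)"
    by (simp add: h_eq)
  then show "prob {\<omega> \<in> space M. (X \<omega>, Y \<omega>) \<in> Q} = (\<integral>\<omega>. prob {\<omega>' \<in> space M. (X \<omega>, Y \<omega>') \<in> Q} \<partial>M)"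
    using meas by (subst integral_eq_nn_integral) (simp_all add: measure_def)
qed

lemma subalgebra_vimage_algebra:
  assumes "X \<in> measurable M S"
  shows "subalgebra M (vimage_algebra (space M) X S)"
  using sets_image_in_sets[OF refl assms] by (simp add: subalgebra_def)

text \<open>
  An event of the \<open>\<sigma>\<close>-algebra of \<open>X\<close> has the form \<open>X \<in> B\<close>.  Integrating over it amounts to replacing
  \<open>Q\<close> by \<open>Q \<inter> (B \<times> UNIV)\<close>, so the defining property of conditional expectation reduces to
  \<open>prob_freeze\<close>.
\<close>
lemma real_cond_exp_freeze:
  assumes X: "X \<in> measurable M S" and Y: "Y \<in> measurable M T"
    and product: "distr M (S \<Otimes>\<^sub>M T) (\<lambda>\<omega>. (X \<omega>, Y \<omega>)) = distr M S X \<Otimes>\<^sub>M distr M T Y"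
    and Q: "Q \<in> sets (S \<Otimes>\<^sub>M T)"
  shows "AE \<omega> in M. real_cond_exp M (vimage_algebra (space M) X S)
      (indicator {\<omega> \<in> space M. (X \<omega>, Y \<omega>) \<in> Q}) \<omega> = prob {\<omega>' \<in> space M. (X \<omega>, Y \<omega>') \<in> Q}"
proof -
  let ?F = "vimage_algebra (space M) X S"
  have sub: "subalgebra M ?F" using X by (rule subalgebra_vimage_algebra)
  interpret F: finite_measure_subalgebra M ?F
    using sub by unfold_locales
  have XY: "(\<lambda>\<omega>. (X \<omega>, Y \<omega>)) \<in> measurable M (S \<Otimes>\<^sub>M T)" using X Y by measurable
  have ev: "{\<omega> \<in> space M. (X \<omega>, Y \<omega>) \<in> Q'} \<in> events" if "Q' \<in> sets (S \<Otimes>\<^sub>M T)" for Q'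
    using measurable_sets[OF XY that] by (simp add: vimage_def Int_def conj_commute)
  let ?g = "\<lambda>\<omega>. prob {\<omega>' \<in> space M. (X \<omega>, Y \<omega>') \<in> Q}"
  have gF: "?g \<in> borel_measurable ?F" by (rule measurable_prob_freeze[OF X Y product Q])
  have gM: "?g \<in> borel_measurable M" by (rule measurable_from_subalg[OF sub gF])
  have g: "integrable M ?g"
    by (rule integrable_const_bound[of _ 1]) (use gM in auto)
  show ?thesis
  proof (rule F.real_cond_exp_charact)
    fix A assume "A \<in> sets ?F"
    then obtain B where B: "B \<in> sets S" "A = X -` B \<inter> space M"
      using X by (subst (asm) sets_vimage_algebra2) (auto dest: measurable_space)
    define Q' where "Q' = Q \<inter> (B \<times> space T)"
    have Q': "Q' \<in> sets (S \<Otimes>\<^sub>M T)" using Q B(1) unfolding Q'_def by measurable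
    have "(\<integral>\<omega>\<in>A. indicator {\<omega> \<in> space M. (X \<omega>, Y \<omega>) \<in> Q} \<omega> \<partial>M)
        = (\<integral>\<omega>. indicator {\<omega> \<in> space M. (X \<omega>, Y \<omega>) \<in> Q'} \<omega> \<partial>M)"
      unfolding set_lebesgue_integral_def using measurable_space[OF Y]
      by (intro Bochner_Integration.integral_cong) (auto simp: indicator_def Q'_def B(2))
    also have "\<dots> = prob {\<omega> \<in> space M. (X \<omega>, Y \<omega>) \<in> Q'}"
      using ev[OF Q'] by simp
    also have "\<dots> = (\<integral>\<omega>. prob {\<omega>' \<in> space M. (X \<omega>, Y \<omega>') \<in> Q'} \<partial>M)"
      by (rule prob_freeze[OF X Y product Q'])
    also have "\<dots> = (\<integral>\<omega>\<in>A. ?g \<omega> \<partial>M)"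
      unfolding set_lebesgue_integral_def
    proof (intro Bochner_Integration.integral_cong refl)
      fix \<omega> assume \<omega>: "\<omega> \<in> space M"
      have "{\<omega>' \<in> space M. (X \<omega>, Y \<omega>') \<in> Q'} = (if \<omega> \<in> A then {\<omega>' \<in> space M. (X \<omega>, Y \<omega>') \<in> Q} else {})"
        using \<omega> measurable_space[OF Y] by (auto simp: Q'_def B(2))
      then show "prob {\<omega>' \<in> space M. (X \<omega>, Y \<omega>') \<in> Q'} = indicat_real A \<omega> *\<^sub>R ?g \<omega>" by simp
    qed
    finally show "(\<integral>\<omega>\<in>A. indicator {\<omega> \<in> space M. (X \<omega>, Y \<omega>) \<in> Q} \<omega> \<partial>M) = (\<integral>\<omega>\<in>A. ?g \<omega> \<partial>M)" .
  next
    show "integrable M (indicat_real {\<omega> \<in> space M. (X \<omega>, Y \<omega>) \<in> Q})"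
      using ev[OF Q] by (intro integrable_real_indicator) (auto simp: emeasure_eq_measure)
  qed (use g gF in auto)
qed

end

section \<open>Independence of groups of random inputs\<close>

definition source_events ::
  "'a measure \<Rightarrow> ('a \<Rightarrow> real^'n) \<Rightarrow> (nat \<Rightarrow> 'a \<Rightarrow> real^'n) \<Rightarrow> (nat \<Rightarrow> 'a \<Rightarrow> real) \<Rightarrow> source \<Rightarrow> 'a set set" where
  "source_events M z0 \<xi> \<zeta> i = (case i of
       Initial \<Rightarrow> {z0 -` A \<inter> space M | A. A \<in> sets borel}
     | Start t \<Rightarrow> {\<xi> t -` A \<inter> space M | A. A \<in> sets borel}
     | Noise t \<Rightarrow> {\<zeta> t -` A \<inter> space M | A. A \<in> sets borel})"

text \<open>
  The information contained in the inputs with index in \<open>I\<close>.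
\<close>
definition source_algebra ::
  "'a measure \<Rightarrow> ('a \<Rightarrow> real^'n) \<Rightarrow> (nat \<Rightarrow> 'a \<Rightarrow> real^'n) \<Rightarrow> (nat \<Rightarrow> 'a \<Rightarrow> real) \<Rightarrow> source set \<Rightarrow> 'a measure" where
  "source_algebra M z0 \<xi> \<zeta> I = sigma (space M) (\<Union>i\<in>I. source_events M z0 \<xi> \<zeta> i)"

lemma source_events_subset: "source_events M z0 \<xi> \<zeta> i \<subseteq> Pow (space M)"
  by (auto simp: source_events_def split: source.splits)

lemma space_source_algebra [simp]: "space (source_algebra M z0 \<xi> \<zeta> I) = space M"
  by (simp add: source_algebra_def space_measure_of_conv)

lemma sets_source_algebra:
  "sets (source_algebra M z0 \<xi> \<zeta> I) = sigma_sets (space M) (\<Union>i\<in>I. source_events M z0 \<xi> \<zeta> i)"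
  unfolding source_algebra_def using source_events_subset[of M z0 \<xi> \<zeta>] by (intro sets_measure_of) auto

lemma
  shows measurable_source_Initial: "Initial \<in> I \<Longrightarrow> z0 \<in> borel_measurable (source_algebra M z0 \<xi> \<zeta> I)"
    and measurable_source_Start: "Start t \<in> I \<Longrightarrow> \<xi> t \<in> borel_measurable (source_algebra M z0 \<xi> \<zeta> I)"
    and measurable_source_Noise: "Noise t \<in> I \<Longrightarrow> \<zeta> t \<in> borel_measurable (source_algebra M z0 \<xi> \<zeta> I)"
proof -
  have *: "A \<in> source_events M z0 \<xi> \<zeta> i \<Longrightarrow> i \<in> I \<Longrightarrow> A \<in> sets (source_algebra M z0 \<xi> \<zeta> I)" for A i
    unfolding sets_source_algebra by auto
  show "Initial \<in> I \<Longrightarrow> z0 \<in> borel_measurable (source_algebra M z0 \<xi> \<zeta> I)"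
    by (intro measurableI *[of _ Initial]) (simp_all add: source_events_def, blast)
  show "Start t \<in> I \<Longrightarrow> \<xi> t \<in> borel_measurable (source_algebra M z0 \<xi> \<zeta> I)"
    by (intro measurableI *[of _ "Start t"]) (simp_all add: source_events_def, blast)
  show "Noise t \<in> I \<Longrightarrow> \<zeta> t \<in> borel_measurable (source_algebra M z0 \<xi> \<zeta> I)"
    by (intro measurableI *[of _ "Noise t"]) (simp_all add: source_events_def, blast)
qed

lemma Int_stable_preimages: "Int_stable {f -` A \<inter> \<Omega> | A. A \<in> sets N}"
proof (rule Int_stableI)
  fix a b assume "a \<in> {f -` A \<inter> \<Omega> | A. A \<in> sets N}" "b \<in> {f -` A \<inter> \<Omega> | A. A \<in> sets N}"
  then obtain A B where "A \<in> sets N" "B \<in> sets N" "a = f -` A \<inter> \<Omega>" "b = f -` B \<inter> \<Omega>"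
    by auto
  then show "a \<inter> b \<in> {f -` A \<inter> \<Omega> | A. A \<in> sets N}"
    by (auto intro!: exI[of _ "A \<inter> B"])
qed

lemma Int_stable_source_events: "Int_stable (source_events M z0 \<xi> \<zeta> i)"
  by (cases i) (simp_all add: source_events_def Int_stable_preimages)

text \<open>
  The generating families are closed under intersection, so independence passes from them to the
  \<open>\<sigma>\<close>-algebras generated by disjoint groups of inputs.
\<close>
lemma (in prob_space)
  assumes indep: "independent_inputs M z0 \<xi> \<zeta>"
  shows subalgebra_source_algebra: "subalgebra M (source_algebra M z0 \<xi> \<zeta> I)"
    and indep_set_disjoint_sources: "I \<inter> J = {} \<Longrightarrow>
      indep_set (sets (source_algebra M z0 \<xi> \<zeta> I)) (sets (source_algebra M z0 \<xi> \<zeta> J))"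
proof -
  let ?E = "source_events M z0 \<xi> \<zeta>"
  have indep': "indep_sets ?E UNIV"
    using indep unfolding independent_inputs_def source_events_def .
  then have "?E i \<subseteq> events" for i by (simp add: indep_sets_def)
  then have "sets (source_algebra M z0 \<xi> \<zeta> I) \<subseteq> events"
    unfolding sets_source_algebra by (intro sets.sigma_sets_subset) auto
  then show "subalgebra M (source_algebra M z0 \<xi> \<zeta> I)" by (simp add: subalgebra_def)
  assume IJ: "I \<inter> J = {}"
  have "indep_sets (\<lambda>b. sigma_sets (space M) (\<Union>i\<in>case_bool I J b. ?E i)) UNIV"
  proof (rule indep_sets_collect_sigma)
    show "indep_sets ?E (\<Union>b\<in>UNIV. case_bool I J b)"
      using indep' by (rule indep_sets_mono_index[rotated]) auto
    show "disjoint_family_on (case_bool I J) UNIV"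
      using IJ by (auto simp: disjoint_family_on_def split: bool.splits)
  qed (rule Int_stable_source_events)
  then show "indep_set (sets (source_algebra M z0 \<xi> \<zeta> I)) (sets (source_algebra M z0 \<xi> \<zeta> J))"
    unfolding indep_set_def by (rule indep_sets_mono_sets) (auto simp: sets_source_algebra split: bool.splits)
qed

lemma (in prob_space) indep_var_if_indep_set:
  assumes indep: "indep_set (sets A) (sets B)" and sub: "subalgebra M A" "subalgebra M B"
    and X: "X \<in> measurable A S" and Y: "Y \<in> measurable B T"
  shows "indep_var S X T Y"
proof -
  have gen: "sigma_sets (space M) {f -` C \<inter> space M | C. C \<in> sets N} \<subseteq> sets A'"
    if "f \<in> measurable A' N" "subalgebra M A'" for f N A'
  proof -
    have space: "space A' = space M" using that(2) by (simp add: subalgebra_def)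
    then have "{f -` C \<inter> space M | C. C \<in> sets N} \<subseteq> sets A'"
      using measurable_sets[OF that(1)] by auto
    then show ?thesis using sets.sigma_sets_subset[of _ A'] by (simp add: space)
  qed
  have "indep_set (sigma_sets (space M) {X -` A \<inter> space M | A. A \<in> sets S})
      (sigma_sets (space M) {Y -` A \<inter> space M | A. A \<in> sets T})"
    using indep unfolding indep_set_def
  proof (rule indep_sets_mono_sets)
    fix b :: bool
    show "case_bool (sigma_sets (space M) {X -` A \<inter> space M | A. A \<in> sets S})
        (sigma_sets (space M) {Y -` A \<inter> space M | A. A \<in> sets T}) b \<subseteq> case_bool (sets A) (sets B) b"
      using gen[OF X sub(1)] gen[OF Y sub(2)] by (cases b) simp_all
  qed
  then show ?thesis
    using measurable_from_subalg[OF sub(1) X] measurable_from_subalg[OF sub(2) Y]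
    by (simp add: indep_var_eq)
qed

lemma (in prob_space) product_law_if_indep_set:
  assumes indep: "indep_set (sets A) (sets B)" and sub: "subalgebra M A" "subalgebra M B"
    and X: "X \<in> measurable A S" and Y: "Y \<in> measurable B T"
  shows "distr M (S \<Otimes>\<^sub>M T) (\<lambda>\<omega>. (X \<omega>, Y \<omega>)) = distr M S X \<Otimes>\<^sub>M distr M T Y"
proof -
  have X': "X \<in> measurable M S" and Y': "Y \<in> measurable M T"
    using measurable_from_subalg[OF sub(1) X] measurable_from_subalg[OF sub(2) Y] .
  have XY: "(\<lambda>\<omega>. (X \<omega>, Y \<omega>)) \<in> measurable M (S \<Otimes>\<^sub>M T)" using X' Y' by measurable
  interpret X: prob_space "distr M S X" using X' by (rule prob_space_distr)
  interpret Y: prob_space "distr M T Y" using Y' by (rule prob_space_distr)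
  have "distr M S X \<Otimes>\<^sub>M distr M T Y = distr M (S \<Otimes>\<^sub>M T) (\<lambda>\<omega>. (X \<omega>, Y \<omega>))"
  proof (rule pair_measure_eqI)
    show "sigma_finite_measure (distr M S X)" "sigma_finite_measure (distr M T Y)"
      by unfold_locales
    show "sets (distr M S X \<Otimes>\<^sub>M distr M T Y) = sets (distr M (S \<Otimes>\<^sub>M T) (\<lambda>\<omega>. (X \<omega>, Y \<omega>)))"
      by (simp cong: sets_pair_measure_cong)
    fix C D assume "C \<in> sets (distr M S X)" "D \<in> sets (distr M T Y)"
    then have CD: "C \<in> sets S" "D \<in> sets T" by simp_all
    have "X -` C \<inter> space M \<in> sets A" "Y -` D \<inter> space M \<in> sets B"
      using measurable_sets[OF X CD(1)] measurable_sets[OF Y CD(2)] sub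
      by (simp_all add: subalgebra_def)
    then have "prob ((X -` C \<inter> space M) \<inter> (Y -` D \<inter> space M))
        = prob (X -` C \<inter> space M) * prob (Y -` D \<inter> space M)"
      by (rule indep_setD[OF indep])
    moreover have "(\<lambda>\<omega>. (X \<omega>, Y \<omega>)) -` (C \<times> D) \<inter> space M = (X -` C \<inter> space M) \<inter> (Y -` D \<inter> space M)"
      by auto
    ultimately show "emeasure (distr M S X) C * emeasure (distr M T Y) D
        = emeasure (distr M (S \<Otimes>\<^sub>M T) (\<lambda>\<omega>. (X \<omega>, Y \<omega>))) (C \<times> D)"
      using CD by (simp add: emeasure_distr[OF X'] emeasure_distr[OF Y'] emeasure_distr[OF XY]
          emeasure_eq_measure ennreal_mult')
  qed
  then show ?thesis by simp
qed

section \<open>Characteristic functions of normal laws\<close>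

text \<open>
  The scaling form covers the degenerate law as well, and so does the characteristic function
  obtained from it.
\<close>
lemma normal_law_eq_scaled_standard:
  assumes "0 \<le> s"
  shows "normal_law s = distr std_normal_distribution borel (\<lambda>x. sqrt s * x)"
proof (cases "s = 0")
  case True
  interpret real_distribution std_normal_distribution by (rule real_dist_normal_dist)
  show ?thesis using True by (simp add: normal_law_def distr_const)
next
  case False
  interpret prob_space std_normal_distribution
    using real_dist_normal_dist by (simp add: real_distribution_def)
  have "distributed std_normal_distribution lborel (\<lambda>x. x) (normal_density 0 1)"
    by (auto simp: distributed_def distr_id2)
  from normal_density_affine[OF this, of "sqrt s" 0] False assms
  have "distr std_normal_distribution lborel (\<lambda>x. sqrt s * x) = density lborel (normal_density 0 (sqrt s))"
    by (simp add: distributed_def)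
  moreover have "distr std_normal_distribution lborel (\<lambda>x. sqrt s * x)
      = distr std_normal_distribution borel (\<lambda>x. sqrt s * x)"
    by (rule distr_cong) simp_all
  ultimately show ?thesis using False by (simp add: normal_law_def)
qed

lemma char_distr_scale:
  assumes "f \<in> borel_measurable M"
  shows "char (distr M borel (\<lambda>x. c * f x)) u = char (distr M borel f) (c * u)"
proof -
  have [measurable]: "f \<in> borel_measurable M" by fact
  show ?thesis unfolding char_def by (simp add: integral_distr mult_ac)
qed

lemma char_normal_law:
  assumes "0 \<le> s"
  shows "char (normal_law s) u = complex_of_real (exp (- (s * u\<^sup>2) / 2))"
proof -
  have "char (normal_law s) u = char (distr std_normal_distribution borel (\<lambda>x. x)) (sqrt s * u)"
    unfolding normal_law_eq_scaled_standard[OF assms] by (rule char_distr_scale) simp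
  also have "distr std_normal_distribution borel (\<lambda>x. x) = std_normal_distribution"
    by (rule distr_id2) simp
  finally show ?thesis
    using assms by (simp add: char_std_normal_distribution power_mult_distrib)
qed

lemma real_distribution_normal_law: "0 \<le> s \<Longrightarrow> real_distribution (normal_law s)"
proof -
  interpret real_distribution std_normal_distribution by (rule real_dist_normal_dist)
  show "0 \<le> s \<Longrightarrow> real_distribution (normal_law s)" by (simp add: normal_law_eq_scaled_standard)
qed

section \<open>Law of the output and accuracy of the subproblems\<close>

lemma fw_v_cong: "(\<And>s. s < t \<Longrightarrow> \<xi> s = \<xi>' s) \<Longrightarrow> fw_v P \<xi> t = fw_v P \<xi>' t"
  by (induction t) simp_all

locale fw_random = fw_problem P + prob_space M
  for P :: "('n::finite, 'd::finite) fw_input" and M :: "'a measure" +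
  fixes z0 :: "'a \<Rightarrow> real^'n" and \<xi> :: "nat \<Rightarrow> 'a \<Rightarrow> real^'n" and \<zeta> :: "nat \<Rightarrow> 'a \<Rightarrow> real"
  assumes measurable_inputs [measurable]: "z0 \<in> borel_measurable M"
      "\<And>t. \<xi> t \<in> borel_measurable M" "\<And>t. \<zeta> t \<in> borel_measurable M"
    and independent: "independent_inputs M z0 \<xi> \<zeta>"
    and z0_gaussian: "is_gaussian (start P) (distr M borel z0)"
    and \<zeta>_standard: "\<And>t. distr M borel (\<zeta> t) = normal_law 1"
    and unit_starts: "\<And>t \<omega>. \<omega> \<in> space M \<Longrightarrow> norm (\<xi> t \<omega>) = 1"
begin

abbreviation "from_sources \<equiv> source_algebra M z0 \<xi> \<zeta>"

abbreviation "coins \<omega> \<equiv> \<lambda>t. \<xi> t \<omega>"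

lemmas subalgebra_sources = subalgebra_source_algebra[OF independent]

lemmas measurable_sources_imp_rv = measurable_from_subalg[OF subalgebra_sources]

lemmas indep_var_sources =
  indep_var_if_indep_set[OF indep_set_disjoint_sources[OF independent] subalgebra_sources subalgebra_sources]

lemmas product_law_sources =
  product_law_if_indep_set[OF indep_set_disjoint_sources[OF independent] subalgebra_sources subalgebra_sources]

lemma feasible_quadratic_form_nonneg: "X \<in> feasible P \<Longrightarrow> 0 \<le> a \<bullet> (X *v a)"
  by (simp add: feasible_def psd_def)

text \<open>
  For frozen start vectors \<open>c\<close>, every functional \<open>a \<bullet> z\<^sub>t\<close> is a sum of independent, possibly degenerate,
  normal variables.  Characteristic functions give its law by induction: the
  factors \<open>\<surd>(1 - \<gamma>)\<close> and \<open>\<surd>\<gamma>\<close> are chosen so that variances combine as \<open>X\<^sub>t\<close> and \<open>H\<^sub>t\<close> do, and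
  \<open>a \<bullet> H\<^sub>t a\<close> is the square of \<open>a \<bullet> D\<close> for the sampling direction \<open>D\<close>.
\<close>
lemma fw_z_gaussian:
  assumes c: "\<And>t. norm (c t) = 1"
  shows "is_gaussian (fw_X P c t) (distr M borel (\<lambda>\<omega>. fw_z P (z0 \<omega>) c (\<lambda>s. \<zeta> s \<omega>) t))"
proof -
  define Z where "Z t \<omega> = fw_z P (z0 \<omega>) c (\<lambda>s. \<zeta> s \<omega>) t" for t \<omega>
  have Z_M [measurable]: "Z t \<in> borel_measurable M" for t
    unfolding Z_def by (rule measurable_fw_z) simp_all
  have X: "fw_X P c t \<in> feasible P" for t using fw_iterates[of c t, OF c] by simp
  \<comment> \<open>\<open>z\<^sub>t\<close> uses only the first \<open>t\<close> normal numbers and is thus independent of \<open>\<zeta>\<^sub>t\<close>.  The bound \<open>m\<close> is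
      decoupled from \<open>t\<close> so that the \<open>\<sigma>\<close>-algebra stays fixed during the induction.\<close>
  have Z_sources: "Z t \<in> borel_measurable (from_sources ({Initial} \<union> Noise ` {..<m}))"
    if "t \<le> m" for t m
    using that
  proof (induction t)
    case 0
    then show ?case by (simp add: Z_def measurable_source_Initial)
  next
    case (Suc t)
    then have [measurable]: "Z t \<in> borel_measurable (from_sources ({Initial} \<union> Noise ` {..<m}))"
        "\<zeta> t \<in> borel_measurable (from_sources ({Initial} \<union> Noise ` {..<m}))"
      by (auto intro!: measurable_source_Noise)
    show ?case unfolding Z_def fw_z.simps unfolding Z_def[symmetric] by measurable
  qed
  have char: "char (distr M borel (\<lambda>\<omega>. a \<bullet> Z t \<omega>)) u
      = complex_of_real (exp (- ((a \<bullet> (fw_X P c t *v a)) * u\<^sup>2) / 2))" for a t u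
  proof (induction t arbitrary: u)
    case 0
    have "distr M borel (\<lambda>\<omega>. a \<bullet> Z 0 \<omega>) = distr (distr M borel z0) borel (\<lambda>x. a \<bullet> x)"
      by (simp add: Z_def distr_distr comp_def)
    also have "\<dots> = normal_law (a \<bullet> (start P *v a))"
      using z0_gaussian by (simp add: is_gaussian_def)
    finally show ?case
      using feasible_quadratic_form_nonneg[OF start_feasible] by (simp add: char_normal_law)
  next
    case (Suc t)
    define \<gamma> where "\<gamma> = step_size t"
    define D where "D = fw_dir P (fw_v P c t) (fw_w P c t)"
    define H where "H = fw_H P (fw_v P c t) (fw_w P c t)"
    have \<gamma>: "0 < \<gamma>" "\<gamma> \<le> 1" unfolding \<gamma>_def by (rule step_size_bounds)+
    have H: "a \<bullet> (H *v a) = (a \<bullet> D)\<^sup>2"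
      using bnd_pos
      by (simp add: H_def D_def fw_H_def fw_dir_def outer_mult_vector inner_commute
          power2_eq_square flip: scaleR_matrix_vector_assoc)
    define U V where "U \<omega> = sqrt (1 - \<gamma>) * (a \<bullet> Z t \<omega>)" and "V \<omega> = (sqrt \<gamma> * (a \<bullet> D)) * \<zeta> t \<omega>" for \<omega>
    have sum: "a \<bullet> Z (Suc t) \<omega> = U \<omega> + V \<omega>" for \<omega>
      by (simp add: Z_def U_def V_def D_def \<gamma>_def inner_add_right)
    have "U \<in> borel_measurable (from_sources ({Initial} \<union> Noise ` {..<t}))"
      unfolding U_def using Z_sources[of t t] by measurable
    moreover have "\<zeta> t \<in> borel_measurable (from_sources {Noise t})"
      by (rule measurable_source_Noise) simp
    then have "V \<in> borel_measurable (from_sources {Noise t})" unfolding V_def by measurable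
    ultimately have "indep_var borel U borel V"
      by (intro indep_var_sources[of "{Initial} \<union> Noise ` {..<t}" "{Noise t}"]) auto
    then have "char (distr M borel (\<lambda>\<omega>. a \<bullet> Z (Suc t) \<omega>)) u
        = char (distr M borel U) u * char (distr M borel V) u"
      unfolding sum by (rule char_distr_add)
    also have "char (distr M borel U) u
        = complex_of_real (exp (- ((a \<bullet> (fw_X P c t *v a)) * (sqrt (1 - \<gamma>) * u)\<^sup>2) / 2))"
      unfolding U_def by (subst char_distr_scale) (simp_all only: Suc, measurable)
    also have "char (distr M borel V) u
        = complex_of_real (exp (- (1 * ((sqrt \<gamma> * (a \<bullet> D)) * u)\<^sup>2) / 2))"
      unfolding V_def by (subst char_distr_scale) (simp_all add: \<zeta>_standard char_normal_law)
    also have "complex_of_real (exp (- ((a \<bullet> (fw_X P c t *v a)) * (sqrt (1 - \<gamma>) * u)\<^sup>2) / 2))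
          * complex_of_real (exp (- (1 * ((sqrt \<gamma> * (a \<bullet> D)) * u)\<^sup>2) / 2))
        = complex_of_real (exp (- ((a \<bullet> (fw_X P c (Suc t) *v a)) * u\<^sup>2) / 2))"
    proof -
      have "a \<bullet> (fw_X P c (Suc t) *v a)
          = (1 - \<gamma>) * (a \<bullet> (fw_X P c t *v a)) + \<gamma> * (a \<bullet> (H *v a))"
        by (simp add: \<gamma>_def H_def matrix_vector_mult_add_rdistrib inner_add_right
            flip: scaleR_matrix_vector_assoc)
      then have "- ((a \<bullet> (fw_X P c (Suc t) *v a)) * u\<^sup>2) / 2
          = - ((a \<bullet> (fw_X P c t *v a)) * (sqrt (1 - \<gamma>) * u)\<^sup>2) / 2
            + - (1 * ((sqrt \<gamma> * (a \<bullet> D)) * u)\<^sup>2) / 2"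
        using \<gamma> unfolding H by (simp add: power_mult_distrib) (simp add: field_simps)
      then show ?thesis by (simp only: exp_add of_real_mult)
    qed
    finally show ?case .
  qed
  have "distr M borel (\<lambda>\<omega>. a \<bullet> Z t \<omega>) = normal_law (a \<bullet> (fw_X P c t *v a))" for a
    using feasible_quadratic_form_nonneg[OF X[of t], of a] char[of a t]
    by (intro Levy_uniqueness real_distribution_normal_law ext) (auto simp: char_normal_law)
  then show ?thesis
    unfolding is_gaussian_def Z_def[symmetric]
    by (auto simp: distr_distr comp_def intro!: prob_space_distr)
qed

text \<open>
  The conditional law at \<open>\<omega>\<close> is the law of the output when the start vectors are frozen at their
  values in \<open>\<omega>\<close>.  The stopping time is then a constant, so \<open>fw_z_gaussian\<close> applies at that time.
\<close>
lemma output_cond_gaussian: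
  "cond_gaussian M (vimage_algebra (space M) coins (PiM UNIV (\<lambda>_. borel)))
     (\<lambda>\<omega>. fw_z P (z0 \<omega>) (coins \<omega>) (\<lambda>t. \<zeta> t \<omega>) (fw_T P (coins \<omega>)))
     (\<lambda>\<omega>. fw_X P (coins \<omega>) (fw_T P (coins \<omega>)))"
proof -
  let ?S = "PiM UNIV (\<lambda>_. borel) :: (nat \<Rightarrow> real^'n) measure"
  let ?T = "borel \<Otimes>\<^sub>M PiM UNIV (\<lambda>_. borel) :: ((real^'n) \<times> (nat \<Rightarrow> real)) measure"
  let ?F = "vimage_algebra (space M) coins ?S"
  define Y where "Y \<omega> = (z0 \<omega>, \<lambda>t. \<zeta> t \<omega>)" for \<omega>
  \<comment> \<open>The output as a function of the start vectors \<open>c\<close>, the initial sample \<open>z\<close> and the numbers \<open>n\<close>.\<close>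
  define \<Phi> where "\<Phi> = (\<lambda>(c, z, n). fw_z P z c n (fw_T P c))"
  have coins_sources: "coins \<in> measurable (from_sources (range Start)) ?S"
    by (intro measurable_abs_UNIV measurable_source_Start) simp
  have Y_sources: "Y \<in> measurable (from_sources ({Initial} \<union> range Noise)) ?T"
    unfolding Y_def
    by (intro measurable_Pair measurable_abs_UNIV measurable_source_Noise measurable_source_Initial)
      simp_all
  note rv = measurable_sources_imp_rv[OF coins_sources] measurable_sources_imp_rv[OF Y_sources]
  have indep: "distr M (?S \<Otimes>\<^sub>M ?T) (\<lambda>\<omega>. (coins \<omega>, Y \<omega>)) = distr M ?S coins \<Otimes>\<^sub>M distr M ?T Y"
    using coins_sources Y_sources by (rule product_law_sources[rotated]) auto
  have \<Phi>: "\<Phi> \<in> borel_measurable (?S \<Otimes>\<^sub>M ?T)"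
    unfolding \<Phi>_def case_prod_beta
    by (rule measurable_compose_countable[OF measurable_fw_z measurable_fw_T]) measurable
  have zhat: "fw_z P (z0 \<omega>) (coins \<omega>) (\<lambda>t. \<zeta> t \<omega>) (fw_T P (coins \<omega>)) = \<Phi> (coins \<omega>, Y \<omega>)" for \<omega>
    by (simp add: \<Phi>_def Y_def)
  have coins_F: "coins \<in> measurable ?F ?S"
    by (rule measurable_vimage_algebra1) (auto simp: space_PiM)
  define \<kappa> where "\<kappa> \<omega> = distr M borel (\<lambda>\<omega>'. \<Phi> (coins \<omega>, Y \<omega>'))" for \<omega>
  have freeze_M: "(\<lambda>\<omega>'. \<Phi> (c, Y \<omega>')) \<in> borel_measurable M" for c
    by (rule measurable_compose[OF _ \<Phi>]) (use rv in \<open>auto simp: space_PiM intro!: measurable_Pair\<close>)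
  show ?thesis
    unfolding cond_gaussian_def zhat
  proof (intro conjI exI[of _ \<kappa>] ballI)
    show "(\<lambda>\<omega>. \<Phi> (coins \<omega>, Y \<omega>)) \<in> borel_measurable M"
      by (rule measurable_compose[OF _ \<Phi>]) (use rv in measurable)
    have "(\<lambda>\<omega>. coins \<omega> t) \<in> borel_measurable ?F" for t
      using measurable_compose[OF coins_F measurable_component_singleton[of t UNIV]] by simp
    then show "(\<lambda>\<omega>. fw_X P (coins \<omega>) (fw_T P (coins \<omega>))) \<in> borel_measurable ?F"
      by (intro measurable_compose_countable[OF measurable_fw_X measurable_fw_T])
  next
    fix \<omega> assume "\<omega> \<in> space M"
    then show "is_gaussian (fw_X P (coins \<omega>) (fw_T P (coins \<omega>))) (\<kappa> \<omega>)"
      unfolding \<kappa>_def by (simp add: \<Phi>_def Y_def fw_z_gaussian unit_starts)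
  next
    fix C :: "(real^'n) set" assume C: "C \<in> sets borel"
    have Q: "\<Phi> -` C \<in> sets (?S \<Otimes>\<^sub>M ?T)"
      using measurable_sets[OF \<Phi> C] by (simp add: space_pair_measure space_PiM)
    have "measure (\<kappa> \<omega>) C = prob {\<omega>' \<in> space M. (coins \<omega>, Y \<omega>') \<in> \<Phi> -` C}" for \<omega>
      unfolding \<kappa>_def by (subst measure_distr[OF freeze_M C]) (simp add: vimage_def Int_def conj_commute)
    moreover have "(\<lambda>\<omega>. \<Phi> (coins \<omega>, Y \<omega>)) -` C \<inter> space M = {\<omega> \<in> space M. (coins \<omega>, Y \<omega>) \<in> \<Phi> -` C}"
      by auto
    ultimately show "AE \<omega> in M. real_cond_exp M ?F (indicator ((\<lambda>\<omega>. \<Phi> (coins \<omega>, Y \<omega>)) -` C \<inter> space M)) \<omega>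
        = measure (\<kappa> \<omega>) C"
      using real_cond_exp_freeze[OF rv indep Q] by simp
  qed
qed

text \<open>
  The point of the \<open>m\<close>-th subproblem and the success of the earlier ones depend on the first \<open>m\<close> start vectors.
  With these frozen, the point is a fixed feasible one, and the fresh start vector solves the
  subproblem with probability at least \<open>1 - p\<close>.  The claim concerns a deterministic number of
  subproblems, for which the recursions are continued beyond the stopping time.
\<close>
lemma prob_accurate:
  assumes lmo: "\<And>t X. X \<in> feasible P \<Longrightarrow>
      prob {\<omega> \<in> space M. lmo_accurate P (\<delta> t) (lin P X) (LMO P t (lin P X) (\<xi> t \<omega>))} \<ge> 1 - p"
    and p: "p \<le> 1"
  shows "prob {\<omega> \<in> space M. \<forall>s<m. lmo_accurate P (\<delta> s) (fw_v P (coins \<omega>) s) (fw_w P (coins \<omega>) s)}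
    \<ge> (1 - p) ^ m"
proof (induction m)
  case 0
  then show ?case by (simp add: prob_space)
next
  case (Suc m)
  define acc where "acc s \<omega> \<longleftrightarrow> lmo_accurate P (\<delta> s) (fw_v P (coins \<omega>) s) (fw_w P (coins \<omega>) s)" for s \<omega>
  define past where "past \<omega> \<longleftrightarrow> (\<forall>s<m. acc s \<omega>)" for \<omega>
  define v where "v \<omega> = fw_v P (coins \<omega>) m" for \<omega>
  let ?S = "borel \<Otimes>\<^sub>M count_space UNIV :: ((real^'d) \<times> bool) measure"
  define Q where "Q = {((v, b), x). b \<and> lmo_accurate P (\<delta> m) v (LMO P m v x)}"
  \<comment> \<open>Discarding the later start vectors makes the dependence on the first \<open>m\<close> visible to the
      measurability lemmas, which speak of whole sequences.\<close>
  define c where "c \<omega> s = (if s < m then \<xi> s \<omega> else 0)" for \<omega> s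
  let ?I = "Start ` {..<m}"
  have c_meas: "(\<lambda>\<omega>. c \<omega> s) \<in> borel_measurable (from_sources ?I)" for s
    by (cases "s < m") (auto simp: c_def intro!: measurable_source_Start)
  have v_c: "fw_v P (coins \<omega>) s = fw_v P (c \<omega>) s" if "s \<le> m" for s \<omega>
    using that by (intro fw_v_cong) (simp add: c_def)
  have w_c: "fw_w P (coins \<omega>) s = fw_w P (c \<omega>) s" if "s < m" for s \<omega>
    using that v_c[of s \<omega>] by (simp add: fw_w_def c_def)
  have v_meas: "v \<in> borel_measurable (from_sources ?I)"
    unfolding v_def v_c[OF order_refl] by (rule measurable_fw_v[OF c_meas])
  have "Measurable.pred (from_sources ?I) (acc s)" if "s < m" for s
    unfolding acc_def using that by (simp add: v_c w_c measurable_fw_accurate[OF c_meas])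
  then have "Measurable.pred (from_sources ?I) (\<lambda>\<omega>. \<forall>s\<in>{..<m}. acc s \<omega>)"
    by (intro pred_intros_finite) auto
  moreover have "past = (\<lambda>\<omega>. \<forall>s\<in>{..<m}. acc s \<omega>)" unfolding past_def by auto
  ultimately have past_meas: "Measurable.pred (from_sources ?I) past" by simp
  define X where "X \<omega> = (v \<omega>, past \<omega>)" for \<omega>
  have X_sources: "X \<in> measurable (from_sources ?I) ?S"
    unfolding X_def using v_meas past_meas by measurable
  have \<xi>_sources: "\<xi> m \<in> borel_measurable (from_sources {Start m})"
    by (rule measurable_source_Start) simp
  note rv = measurable_sources_imp_rv[OF X_sources] measurable_sources_imp_rv[OF \<xi>_sources]
  have indep: "distr M (?S \<Otimes>\<^sub>M borel) (\<lambda>\<omega>. (X \<omega>, \<xi> m \<omega>)) = distr M ?S X \<Otimes>\<^sub>M distr M borel (\<xi> m)"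
    using X_sources \<xi>_sources by (rule product_law_sources[rotated]) auto
  have "Measurable.pred (?S \<Otimes>\<^sub>M borel) (\<lambda>x. x \<in> Q)"
  proof -
    note measurable_lmo_accurate[measurable] measurable_LMO[measurable]
    show ?thesis unfolding Q_def case_prod_beta mem_Collect_eq by measurable
  qed
  then have Q: "Q \<in> sets (?S \<Otimes>\<^sub>M borel)"
    by (simp add: pred_def space_pair_measure)
  have "prob {\<omega> \<in> space M. \<forall>s<Suc m. acc s \<omega>} = prob {\<omega> \<in> space M. (X \<omega>, \<xi> m \<omega>) \<in> Q}"
    by (rule arg_cong[where f = prob])
      (auto simp: Q_def X_def past_def acc_def v_def fw_w_def less_Suc_eq)
  also have "\<dots> = (\<integral>\<omega>. prob {\<omega>' \<in> space M. (X \<omega>, \<xi> m \<omega>') \<in> Q} \<partial>M)"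
    by (rule prob_freeze[OF rv indep Q])
  also have "\<dots> \<ge> (\<integral>\<omega>. (1 - p) * indicator {\<omega> \<in> space M. past \<omega>} \<omega> \<partial>M)"
  proof (rule integral_mono)
    have "past \<in> measurable M (count_space UNIV)"
      using past_meas by (rule measurable_sources_imp_rv)
    then show "integrable M (\<lambda>\<omega>. (1 - p) * indicator {\<omega> \<in> space M. past \<omega>} \<omega>)"
      by (intro integrable_mult_right integrable_real_indicator)
        (auto simp: emeasure_eq_measure pred_def)
    show "integrable M (\<lambda>\<omega>. prob {\<omega>' \<in> space M. (X \<omega>, \<xi> m \<omega>') \<in> Q})"
      using measurable_from_subalg[OF subalgebra_vimage_algebra[OF rv(1)]
          measurable_prob_freeze[OF rv indep Q]]
      by (intro integrable_const_bound[of _ 1]) auto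
    fix \<omega> assume \<omega>: "\<omega> \<in> space M"
    have iterate: "fw_X P (coins \<omega>) m \<in> feasible P" "v \<omega> = lin P (fw_X P (coins \<omega>) m)"
      using fw_iterates[of "coins \<omega>" m] unit_starts[OF \<omega>] by (simp_all add: v_def)
    show "(1 - p) * indicat_real {\<omega> \<in> space M. past \<omega>} \<omega>
        \<le> prob {\<omega>' \<in> space M. (X \<omega>, \<xi> m \<omega>') \<in> Q}"
      using lmo[OF iterate(1), of m] \<omega> by (cases "past \<omega>") (simp_all add: Q_def X_def iterate(2))
  qed
  also have "(\<integral>\<omega>. (1 - p) * indicator {\<omega> \<in> space M. past \<omega>} \<omega> \<partial>M) = (1 - p) * prob {\<omega> \<in> space M. past \<omega>}"
  proof -
    have "{\<omega> \<in> space M. past \<omega>} \<inter> space M = {\<omega> \<in> space M. past \<omega>}" by auto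
    then show ?thesis by (simp only: integral_mult_right_zero Bochner_Integration.integral_indicator)
  qed
  finally have "prob {\<omega> \<in> space M. \<forall>s<Suc m. acc s \<omega>} \<ge> (1 - p) * prob {\<omega> \<in> space M. past \<omega>}" .
  moreover have "(1 - p) * (1 - p) ^ m \<le> (1 - p) * prob {\<omega> \<in> space M. past \<omega>}"
    using Suc p by (intro mult_left_mono) (simp_all add: past_def acc_def)
  ultimately show ?case by (simp add: acc_def)
qed

end

section \<open>Execution and memory of the program\<close>

lemma exec_deterministic: "exec P c s s1 \<Longrightarrow> exec P c s s2 \<Longrightarrow> s1 = s2"
proof (induction arbitrary: s2 rule: exec.induct)
  case (9 c1 s s' c2 s'')
  from "9.prems" show ?case by (cases rule: exec.cases) (use "9.IH" in blast)+
next
  case (13 s a b c s' s'')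
  from "13.prems" show ?case by (cases rule: exec.cases) (use 13 in blast)+
qed (erule exec.cases; blast)+

text \<open>
  As equivalences the rules let the simplifier execute straight-line code symbolically.
\<close>
lemma exec_SSet: "exec P (SSet i a) s s' \<longleftrightarrow> s' = s\<lparr>sreg := (sreg s)(i := sval P s a)\<rparr>"
  and exec_NComb: "exec P (NComb i a j b k) s s' \<longleftrightarrow>
     s' = s\<lparr>nreg := (nreg s)(i := sval P s a *\<^sub>R nreg s j + sval P s b *\<^sub>R nreg s k)\<rparr>"
  and exec_DComb: "exec P (DComb i a j b k) s s' \<longleftrightarrow>
     s' = s\<lparr>dreg := (dreg s)(i := sval P s a *\<^sub>R dreg s j + sval P s b *\<^sub>R dreg s k)\<rparr>"
  and exec_MatVec: "exec P (MatVec i j k) s s' \<longleftrightarrow>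
     s' = s\<lparr>nreg := (nreg s)(i := Jmat P (dreg s j) *v nreg s k)\<rparr>"
  and exec_Grad: "exec P (Grad i j) s s' \<longleftrightarrow>
     s' = s\<lparr>dreg := (dreg s)(i := grad (obj P) (dreg s j))\<rparr>"
  and exec_Meas: "exec P (Meas i a k) s s' \<longleftrightarrow>
     s' = s\<lparr>dreg := (dreg s)(i := lin P (sval P s a *\<^sub>R outer (nreg s k)))\<rparr>"
  and exec_DrawStart: "exec P (DrawStart i) s s' \<longleftrightarrow>
     s' = s\<lparr>nreg := (nreg s)(i := starts s 0), starts := (\<lambda>m. starts s (Suc m))\<rparr>"
  and exec_DrawNormal: "exec P (DrawNormal i) s s' \<longleftrightarrow>
     s' = s\<lparr>sreg := (sreg s)(i := normals s 0), normals := (\<lambda>m. normals s (Suc m))\<rparr>"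
  and exec_Seq: "exec P (c1 ;; c2) s s' \<longleftrightarrow> (\<exists>r. exec P c1 s r \<and> exec P c2 r s')"
  and exec_IfLe: "exec P (IfLe a b c1 c2) s s' \<longleftrightarrow>
     (if sval P s a \<le> sval P s b then exec P c1 s s' else exec P c2 s s')"
  and exec_WhileLt: "exec P (WhileLt a b c) s s' \<longleftrightarrow>
     (if sval P s a < sval P s b then \<exists>r. exec P c s r \<and> exec P (WhileLt a b c) r s' else s' = s)"
  by (auto intro: exec.intros elim: exec.cases split: if_splits)

lemmas exec_iff = exec_SSet exec_NComb exec_DComb exec_MatVec exec_Grad exec_Meas exec_DrawStart
  exec_DrawNormal exec_Seq exec_IfLe

lemma exec_Seq_exI:
  "exec P c1 s r \<Longrightarrow> \<exists>s'. exec P c2 r s' \<and> Q s' \<Longrightarrow> \<exists>s'. exec P (c1 ;; c2) s s' \<and> Q s'"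
  by (auto simp: exec_Seq)

text \<open>
  The registers and streams that the rest of the program relies on across a power iteration.
\<close>
definition keeps :: "('n::finite, 'd::finite) mstate \<Rightarrow> ('n, 'd) mstate \<Rightarrow> bool" where
  "keeps s s' \<longleftrightarrow> nreg s' 0 = nreg s 0 \<and> dreg s' = dreg s \<and> sreg s' 0 = sreg s 0 \<and>
     starts s' = starts s \<and> normals s' = normals s"

abbreviation power_body :: com where
  "power_body \<equiv>
     MatVec 2 0 1 ;;
     NComb 2 (Num 1) 2 (Shift (Reg 0)) 1 ;;
     SSet 2 (Sqrt (NDot 2 2)) ;;
     IfLe (Reg 2) (Num 0)
       (SSet 2 (Num 0))
       (NComb 1 (Dvd (Num 1) (Reg 2)) 2 (Num 0) 1) ;;
     SSet 1 (Add (Reg 1) (Num 1))"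

lemma exec_power_step:
  assumes "sreg s 0 = real t"
  shows "\<exists>s'. exec P power_body s s' \<and> keeps s s' \<and> sreg s' 1 = sreg s 1 + 1 \<and>
     nreg s' 1 = power_step (Jmat P (dreg s 0)) (shift P t) (nreg s 1)"
  using assms by (simp add: exec_iff power_step_def Let_def keeps_def flip: norm_eq_sqrt_inner)

lemma exec_power_loop:
  assumes "sreg s 0 = real t" "sreg s 1 = real k" "k \<le> iters P t"
    "nreg s 1 = (power_step (Jmat P (dreg s 0)) (shift P t) ^^ k) x"
  shows "\<exists>s'. exec P (WhileLt (Reg 1) (Iters (Reg 0)) power_body) s s' \<and> keeps s s' \<and>
     nreg s' 1 = (power_step (Jmat P (dreg s 0)) (shift P t) ^^ iters P t) x"
  using assms
proof (induction "iters P t - k" arbitrary: s k)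
  case 0
  then show ?case by (subst exec_WhileLt) (simp add: keeps_def)
next
  case (Suc m)
  from exec_power_step[OF Suc.prems(1), where P = P]
  obtain r where r: "exec P power_body s r" "keeps s r" "sreg r 1 = sreg s 1 + 1"
    "nreg r 1 = power_step (Jmat P (dreg s 0)) (shift P t) (nreg s 1)" by blast
  have same: "sreg r 0 = real t" "dreg r = dreg s" using r(2) Suc.prems(1) by (simp_all add: keeps_def)
  have "\<exists>s'. exec P (WhileLt (Reg 1) (Iters (Reg 0)) power_body) r s' \<and> keeps r s' \<and>
     nreg s' 1 = (power_step (Jmat P (dreg r 0)) (shift P t) ^^ iters P t) x"
    by (rule Suc.hyps(1)[of "Suc k"]) (use Suc.hyps(2) Suc.prems r same in auto)
  then obtain s' where s': "exec P (WhileLt (Reg 1) (Iters (Reg 0)) power_body) r s'" "keeps r s'"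
     "nreg s' 1 = (power_step (Jmat P (dreg s 0)) (shift P t) ^^ iters P t) x"
    unfolding same by blast
  have "exec P (WhileLt (Reg 1) (Iters (Reg 0)) power_body) s s'"
    by (rule exec.intros(13)[OF _ r(1) s'(1)]) (use Suc.hyps(2) Suc.prems in simp)
  then show ?case using s' r(2) by (auto simp: keeps_def)
qed

lemma exec_power_program:
  assumes "sreg s 0 = real t"
  shows "\<exists>s'. exec P power_program s s' \<and> nreg s' 1 = LMO P t (dreg s 0) (starts s 0) \<and>
     nreg s' 0 = nreg s 0 \<and> dreg s' = dreg s \<and> sreg s' 0 = sreg s 0 \<and>
     starts s' = (\<lambda>m. starts s (Suc m)) \<and> normals s' = normals s"
proof -
  define r where "r = s\<lparr>nreg := (nreg s)(1 := starts s 0), starts := (\<lambda>m. starts s (Suc m)),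
    sreg := (sreg s)(1 := 0)\<rparr>"
  from exec_power_loop[of r t 0 P "starts s 0"] assms show ?thesis
    unfolding power_program_def exec_iff
    by (auto simp: r_def LMO_def keeps_def)
qed

text \<open>
  The program stores only the length of the sampling direction, in number register 3; the direction
  itself is the product of this number with \<open>w\<close>.
\<close>
lemma exec_direction_program:
  fixes P :: "('n::finite, 'd::finite) fw_input"
  assumes t: "sreg s 0 = real t"
  defines "w \<equiv> LMO P t (dreg s 0) (starts s 0)"
  defines "q \<equiv> fw_q P (dreg s 0) w"
  shows "\<exists>s'. exec P (direction_program (bnd P)) s s' \<and>
     nreg s' 0 = nreg s 0 \<and> nreg s' 1 = w \<and> dreg s' 0 = dreg s 0 \<and> dreg s' 1 = q \<and>
     sreg s' 0 = sreg s 0 \<and> sreg s' 3 *\<^sub>R w = fw_dir P (dreg s 0) w \<and>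
     sreg s' 4 = (q - dreg s 0) \<bullet> grad (obj P) (dreg s 0) \<and>
     starts s' = (\<lambda>m. starts s (Suc m)) \<and> normals s' = normals s"
proof -
  obtain r where r: "exec P power_program s r" "nreg r 1 = w"
    "nreg r 0 = nreg s 0" "dreg r = dreg s" "sreg r 0 = sreg s 0"
    "starts r = (\<lambda>m. starts s (Suc m))" "normals r = normals s"
    using exec_power_program[OF t, of P] unfolding w_def by blast
  show ?thesis unfolding direction_program_def
  proof (rule exec_Seq_exI[OF r(1)], goal_cases)
    case 1
    show ?case
      by (cases "ascent P (dreg s 0) w")
        (simp_all add: exec_iff r[simplified] q_def fw_q_def fw_dir_def ascent_def inner_diff_left)
  qed
qed

text \<open>
  The loop invariant at the test of the main loop, when the direction of iteration \<open>t\<close> has been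
  computed: one start vector more than normal numbers has been consumed.
\<close>
definition represents ::
  "('n::finite, 'd::finite) fw_input \<Rightarrow> real^'n \<Rightarrow> (nat \<Rightarrow> real^'n) \<Rightarrow> (nat \<Rightarrow> real) \<Rightarrow> nat
    \<Rightarrow> ('n, 'd) mstate \<Rightarrow> bool" where
  "represents P z0 \<xi> \<zeta> t s \<longleftrightarrow>
     nreg s 0 = fw_z P z0 \<xi> \<zeta> t \<and> nreg s 1 = fw_w P \<xi> t \<and>
     dreg s 0 = fw_v P \<xi> t \<and> dreg s 1 = fw_q P (fw_v P \<xi> t) (fw_w P \<xi> t) \<and>
     sreg s 0 = real t \<and> sreg s 3 *\<^sub>R fw_w P \<xi> t = fw_dir P (fw_v P \<xi> t) (fw_w P \<xi> t) \<and>
     (sreg s 4 \<le> eps P \<longleftrightarrow> fw_stop P \<xi> t) \<and>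
     starts s = (\<lambda>m. \<xi> (Suc t + m)) \<and> normals s = (\<lambda>m. \<zeta> (t + m))"

lemma exec_direction_represents:
  assumes "nreg s 0 = fw_z P z0 \<xi> \<zeta> t" "dreg s 0 = fw_v P \<xi> t" "sreg s 0 = real t"
    "starts s = (\<lambda>m. \<xi> (t + m))" "normals s = (\<lambda>m. \<zeta> (t + m))"
  shows "\<exists>s'. exec P (direction_program (bnd P)) s s' \<and> represents P z0 \<xi> \<zeta> t s'"
proof -
  have w: "LMO P t (dreg s 0) (starts s 0) = fw_w P \<xi> t" using assms by (simp add: fw_w_def)
  show ?thesis
    using exec_direction_program[OF assms(3), of P] unfolding w
    by (auto simp: represents_def assms fw_stop_def)
qed

abbreviation fw_body :: "real \<Rightarrow> com" where
  "fw_body \<alpha> \<equiv>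
     SSet 5 (Dvd (Num 2) (Add (Reg 0) (Num 2))) ;;
     DrawNormal 6 ;;
     NComb 0 (Sqrt (Sub (Num 1) (Reg 5))) 0
             (Mul (Mul (Sqrt (Reg 5)) (Reg 6)) (Reg 3)) 1 ;;
     DComb 0 (Sub (Num 1) (Reg 5)) 0 (Reg 5) 1 ;;
     SSet 0 (Add (Reg 0) (Num 1)) ;;
     direction_program \<alpha>"

lemma exec_fw_iteration:
  assumes "represents P z0 \<xi> \<zeta> t s"
  shows "\<exists>s'. exec P (fw_body (bnd P)) s s' \<and> represents P z0 \<xi> \<zeta> (Suc t) s'"
proof -
  have dir: "(c * sreg s 3) *\<^sub>R fw_w P \<xi> t = c *\<^sub>R fw_dir P (fw_v P \<xi> t) (fw_w P \<xi> t)" for c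
    using assms by (simp add: represents_def flip: scaleR_scaleR)
  note s = assms[unfolded represents_def, simplified]
  show ?thesis
    by ((rule exec_Seq_exI, rule exec.intros)+, rule exec_direction_represents)
      (simp_all add: s dir step_size_def fw_w_def[symmetric])
qed

lemma exec_fw_loop:
  assumes "represents P z0 \<xi> \<zeta> t s" "t \<le> T" "fw_stop P \<xi> T" "\<And>i. i < T \<Longrightarrow> \<not> fw_stop P \<xi> i"
  shows "\<exists>s'. exec P (WhileLt (Num (eps P)) (Reg 4) (fw_body (bnd P))) s s' \<and> represents P z0 \<xi> \<zeta> T s'"
  using assms(1,2)
proof (induction "T - t" arbitrary: s t)
  case 0
  then have "t = T" by simp
  with 0 assms(3) show ?case by (subst exec_WhileLt) (auto simp: represents_def)
next
  case (Suc m)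
  obtain r where r: "exec P (fw_body (bnd P)) s r" "represents P z0 \<xi> \<zeta> (Suc t) r"
    using exec_fw_iteration[OF Suc.prems(1)] by blast
  obtain s' where s': "exec P (WhileLt (Num (eps P)) (Reg 4) (fw_body (bnd P))) r s'" "represents P z0 \<xi> \<zeta> T s'"
    using Suc.hyps(1)[OF _ r(2)] Suc.hyps(2) by force
  have "\<not> fw_stop P \<xi> t" using assms(4) Suc.hyps(2) by simp
  then have "sval P s (Num (eps P)) < sval P s (Reg 4)"
    using Suc.prems(1) by (simp add: represents_def)
  from exec.intros(13)[OF this r(1) s'(1)] s'(2) show ?case by blast
qed

lemma exec_fw_program:
  assumes stops: "\<exists>t. fw_stop P \<xi> t"
  shows "\<exists>s. exec P (fw_program (bnd P) (eps P)) (init_state z0 (lin P (start P)) \<xi> \<zeta>) s \<and>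
     nreg s 0 = fw_z P z0 \<xi> \<zeta> (fw_T P \<xi>) \<and> dreg s 0 = fw_v P \<xi> (fw_T P \<xi>)"
proof -
  define s0 where "s0 = init_state z0 (lin P (start P)) \<xi> \<zeta>"
  have s0: "exec P (SSet 0 (Num 0)) s0 s0"
    by (simp add: exec_SSet s0_def init_state_def fun_upd_def)
  obtain r where r: "exec P (direction_program (bnd P)) s0 r" "represents P z0 \<xi> \<zeta> 0 r"
    using exec_direction_represents[of s0 P z0 \<xi> \<zeta> 0] by (auto simp: s0_def init_state_def)
  have T: "fw_stop P \<xi> (fw_T P \<xi>)" "\<And>i. i < fw_T P \<xi> \<Longrightarrow> \<not> fw_stop P \<xi> i"
    unfolding fw_T_def using stops by (auto intro: LeastI_ex dest: not_less_Least)
  from exec_fw_loop[OF r(2) _ T]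
  show ?thesis
    unfolding fw_program_def s0_def[symmetric]
    by (intro exec_Seq_exI[OF s0] exec_Seq_exI[OF r(1)]) (auto simp: represents_def)
qed

text \<open>
  Three registers and a buffer for each kind of vector, seven numbers, and ten intermediate results
  for the longest expressions, those in the update of \<open>z\<close>.  The sum \<open>4 n + 4 d + 17\<close> is at most
  \<open>13 (n + d)\<close> because \<open>n + d \<ge> 2\<close>.
\<close>
lemma working_memory_fw_program:
  assumes "1 \<le> n" "1 \<le> d"
  shows "working_memory (fw_program \<alpha> \<epsilon>) n d \<le> 13 * (n + d)"
proof -
  let ?c = "fw_program \<alpha> \<epsilon>"
  note defs = fw_program_def direction_program_def power_program_def
  have "com_nregs ?c \<union> \<Union> (sexp_nregs ` com_sexps ?c) \<subseteq> {0, 1, 2}"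
    and "com_dregs ?c \<union> \<Union> (sexp_dregs ` com_sexps ?c) \<subseteq> {0, 1, 2}"
    and "com_sregs ?c \<union> \<Union> (sexp_sregs ` com_sexps ?c) \<subseteq> {0, 1, 2, 3, 4, 5, 6}"
    by (simp_all add: defs)
  from this[THEN card_mono[rotated]]
  have cards: "card (com_nregs ?c \<union> \<Union> (sexp_nregs ` com_sexps ?c)) \<le> 3"
    "card (com_dregs ?c \<union> \<Union> (sexp_dregs ` com_sexps ?c)) \<le> 3"
    "card (com_sregs ?c \<union> \<Union> (sexp_sregs ` com_sexps ?c)) \<le> 7"
    by (simp_all add: card_insert_if)
  moreover have "com_temps ?c \<le> 10" by (simp add: defs)
  ultimately show ?thesis
    using mult_le_mono2[OF cards(1), of n] mult_le_mono2[OF cards(2), of d] assms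
    unfolding working_memory_def add_mult_distrib2 by linarith
qed

section \<open>The output of the algorithm\<close>

theorem proposition3p1:
  fixes P :: "('n::finite, 'd::finite) fw_input"
    and M :: "'a measure"
    and z0 :: "'a \<Rightarrow> real^'n"
    and \<xi> :: "nat \<Rightarrow> 'a \<Rightarrow> real^'n"
    and \<zeta> :: "nat \<Rightarrow> 'a \<Rightarrow> real"
    and \<eta> p Cu :: real
  assumes concave: "concave_on UNIV (obj P)"
    and smooth: "\<And>v. obj P differentiable (at v)" "continuous_on UNIV (grad (obj P))"
    and linear: "linear_on_sym (lin P)"
    and parameters: "0 < bnd P" "0 < eps P" "0 \<le> \<eta>" "0 \<le> p" "p < 1"
    and start: "start P \<in> feasible P"
    and curv: "curvature P \<le> ereal Cu"
    and prob: "prob_space M"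
    and rv: "z0 \<in> borel_measurable M" "\<And>t. \<xi> t \<in> borel_measurable M"
      "\<And>t. \<zeta> t \<in> borel_measurable M"
    and indep: "independent_inputs M z0 \<xi> \<zeta>"
    and z0: "is_gaussian (start P) (distr M borel z0)"
    and \<zeta>: "\<And>t. distr M borel (\<zeta> t) = normal_law 1"
    and unit: "\<And>t \<omega>. \<omega> \<in> space M \<Longrightarrow> norm (\<xi> t \<omega>) = 1"
    and lmo: "\<And>t X. X \<in> feasible P \<Longrightarrow>
      measure M {\<omega> \<in> space M. lmo_accurate P (1/2 * \<eta> * step_size t * Cu) (lin P X)
                                (LMO P t (lin P X) (\<xi> t \<omega>))} \<ge> 1 - p"
  shows
    "let coins = (\<lambda>\<omega> t. \<xi> t \<omega>);
         F = vimage_algebra (space M) coins (PiM UNIV (\<lambda>_. borel));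
         T = (\<lambda>\<omega>. fw_T P (coins \<omega>));
         zhat = (\<lambda>\<omega>. fw_z P (z0 \<omega>) (coins \<omega>) (\<lambda>t. \<zeta> t \<omega>) (T \<omega>));
         vhat = (\<lambda>\<omega>. fw_v P (coins \<omega>) (T \<omega>));
         Xhat = (\<lambda>\<omega>. fw_X P (coins \<omega>) (T \<omega>));
         acc = (\<lambda>\<delta> t \<omega>. lmo_accurate P \<delta> (fw_v P (coins \<omega>) t) (fw_w P (coins \<omega>) t))
     in
       (\<exists>N. \<forall>\<omega>\<in>space M. \<exists>t\<le>N. fw_stop P (coins \<omega>) t)
     \<and> cond_gaussian M F zhat Xhat
     \<and> (\<forall>\<omega>\<in>space M. Xhat \<omega> \<in> feasible P \<and> vhat \<omega> = lin P (Xhat \<omega>))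
     \<and> (\<forall>\<omega>\<in>space M. \<forall>\<delta>\<ge>0. acc \<delta> (T \<omega>) \<omega> \<longrightarrow> eps_optimal P (eps P + \<delta>) (Xhat \<omega>))
     \<and> (\<forall>N. (\<forall>\<omega>\<in>space M. T \<omega> \<le> N) \<longrightarrow>
          measure M {\<omega> \<in> space M. \<forall>t\<le>T \<omega>. acc (1/2 * \<eta> * step_size t * Cu) t \<omega>}
            \<ge> (1 - p) ^ (N + 1))
     \<and> (\<eta> = 0 \<longrightarrow> p = 0 \<longrightarrow> (AE \<omega> in M. eps_optimal P (eps P) (Xhat \<omega>)))
     \<and> (\<forall>\<omega>\<in>space M.
          let run = exec P (fw_program (bnd P) (eps P))
                      (init_state (z0 \<omega>) (lin P (start P)) (coins \<omega>) (\<lambda>t. \<zeta> t \<omega>))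
          in (\<exists>s. run s) \<and> (\<forall>s. run s \<longrightarrow> nreg s 0 = zhat \<omega> \<and> dreg s 0 = vhat \<omega>))
     \<and> working_memory (fw_program (bnd P) (eps P)) CARD('n) CARD('d)
          \<le> 13 * (CARD('n) + CARD('d))"
proof -
  interpret fw_random P M z0 \<xi> \<zeta>
    by (intro fw_random.intro fw_problem.intro fw_random_axioms.intro)
      (use assms in simp_all)
  let ?F = "vimage_algebra (space M) coins (PiM UNIV (\<lambda>_. borel))"
  have coins_unit: "norm (coins \<omega> t) = 1" if "\<omega> \<in> space M" for \<omega> t
    using unit that by simp
  obtain N where bound: "\<forall>c. (\<forall>t. norm (c t) = 1) \<longrightarrow> (\<exists>t\<le>N. fw_stop P c t)"
    using stopping_time_bounded[OF curv parameters(2)] by (rule exE)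
  have N: "\<exists>t\<le>N. fw_stop P (coins \<omega>) t" if "\<omega> \<in> space M" for \<omega>
    by (rule bound[rule_format]) (rule coins_unit[OF that])
  have T_stop: "fw_stop P (coins \<omega>) (fw_T P (coins \<omega>))" if "\<omega> \<in> space M" for \<omega>
    unfolding fw_T_def using N[OF that] by (blast intro: LeastI)
  have T_le: "fw_T P (coins \<omega>) \<le> N" if "\<omega> \<in> space M" for \<omega>
    using N[OF that] Least_le[of "fw_stop P (coins \<omega>)"] unfolding fw_T_def by (blast intro: order_trans)
  have eps_opt: "eps_optimal P (eps P + \<delta>) (fw_X P (coins \<omega>) (fw_T P (coins \<omega>)))"
    if "\<omega> \<in> space M" "0 \<le> \<delta>"
      "lmo_accurate P \<delta> (fw_v P (coins \<omega>) (fw_T P (coins \<omega>))) (fw_w P (coins \<omega>) (fw_T P (coins \<omega>)))"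
    for \<omega> \<delta>
    using that coins_unit by (intro stop_imp_eps_optimal T_stop) auto
  define acc where "acc t \<omega> \<longleftrightarrow> lmo_accurate P (1/2 * \<eta> * step_size t * Cu)
      (fw_v P (coins \<omega>) t) (fw_w P (coins \<omega>) t)" for t \<omega>
  have acc_meas [measurable]: "Measurable.pred M (acc t)" for t
    unfolding acc_def by (rule measurable_fw_accurate) measurable
  have T_meas [measurable]: "(\<lambda>\<omega>. fw_T P (coins \<omega>)) \<in> measurable M (count_space UNIV)"
    by (rule measurable_fw_T) measurable
  \<comment> \<open>Success in the first \<open>m + 1\<close> subproblems includes those up to a stopping time of at most \<open>m\<close>.\<close>
  have all_acc: "prob {\<omega> \<in> space M. \<forall>t\<le>fw_T P (coins \<omega>). acc t \<omega>} \<ge> (1 - p) ^ (m + 1)"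
    if m: "\<And>\<omega>. \<omega> \<in> space M \<Longrightarrow> fw_T P (coins \<omega>) \<le> m" for m
  proof -
    have "(1 - p) ^ Suc m \<le> prob {\<omega> \<in> space M. \<forall>s<Suc m. acc s \<omega>}"
      unfolding acc_def using lmo parameters(5) by (intro prob_accurate) simp_all
    also have "\<dots> \<le> prob {\<omega> \<in> space M. \<forall>t\<le>fw_T P (coins \<omega>). acc t \<omega>}"
    proof (rule finite_measure_mono)
      have "Measurable.pred M (\<lambda>\<omega>. \<forall>t. t \<le> fw_T P (coins \<omega>) \<longrightarrow> acc t \<omega>)" by measurable
      then show "{\<omega> \<in> space M. \<forall>t\<le>fw_T P (coins \<omega>). acc t \<omega>} \<in> events" by (simp add: pred_def)
    qed (use m in force)
    finally show ?thesis by simp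
  qed
  have exact: "AE \<omega> in M. eps_optimal P (eps P) (fw_X P (coins \<omega>) (fw_T P (coins \<omega>)))"
    if "\<eta> = 0" "p = 0"
  proof -
    have "prob {\<omega> \<in> space M. \<forall>t\<le>fw_T P (coins \<omega>). acc t \<omega>} = 1"
      using all_acc[OF T_le] that by (simp add: measure_ge_1_iff)
    then have "AE \<omega> in M. \<omega> \<in> {\<omega> \<in> space M. \<forall>t\<le>fw_T P (coins \<omega>). acc t \<omega>}"
      by (subst (asm) prob_eq_1) measurable
    then show ?thesis
    proof (rule AE_mp, intro AE_I2 impI)
      fix \<omega> assume "\<omega> \<in> space M" "\<omega> \<in> {\<omega> \<in> space M. \<forall>t\<le>fw_T P (coins \<omega>). acc t \<omega>}"
      then show "eps_optimal P (eps P) (fw_X P (coins \<omega>) (fw_T P (coins \<omega>)))"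
        using eps_opt[of \<omega> 0] that by (simp add: acc_def)
    qed
  qed
  have run: "\<exists>s. exec P (fw_program (bnd P) (eps P))
        (init_state (z0 \<omega>) (lin P (start P)) (coins \<omega>) (\<lambda>t. \<zeta> t \<omega>)) s \<and>
      nreg s 0 = fw_z P (z0 \<omega>) (coins \<omega>) (\<lambda>t. \<zeta> t \<omega>) (fw_T P (coins \<omega>)) \<and>
      dreg s 0 = fw_v P (coins \<omega>) (fw_T P (coins \<omega>))" if "\<omega> \<in> space M" for \<omega>
    using T_stop[OF that] by (intro exec_fw_program) blast
  have memory: "working_memory (fw_program (bnd P) (eps P)) CARD('n) CARD('d) \<le> 13 * (CARD('n) + CARD('d))"
    by (rule working_memory_fw_program) (simp_all add: Suc_le_eq)
  show ?thesis
    unfolding Let_def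
  proof (intro conjI)
    show "\<exists>N. \<forall>\<omega>\<in>space M. \<exists>t\<le>N. fw_stop P (coins \<omega>) t" using N by blast
    show "\<forall>\<omega>\<in>space M. fw_X P (coins \<omega>) (fw_T P (coins \<omega>)) \<in> feasible P \<and>
        fw_v P (coins \<omega>) (fw_T P (coins \<omega>)) = lin P (fw_X P (coins \<omega>) (fw_T P (coins \<omega>)))"
      by (intro ballI fw_iterates) (rule coins_unit)
    show "\<forall>\<omega>\<in>space M.
        (\<exists>s. exec P (fw_program (bnd P) (eps P))
          (init_state (z0 \<omega>) (lin P (start P)) (coins \<omega>) (\<lambda>t. \<zeta> t \<omega>)) s) \<and>
        (\<forall>s. exec P (fw_program (bnd P) (eps P))
          (init_state (z0 \<omega>) (lin P (start P)) (coins \<omega>) (\<lambda>t. \<zeta> t \<omega>)) s \<longrightarrow>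
          nreg s 0 = fw_z P (z0 \<omega>) (coins \<omega>) (\<lambda>t. \<zeta> t \<omega>) (fw_T P (coins \<omega>)) \<and>
          dreg s 0 = fw_v P (coins \<omega>) (fw_T P (coins \<omega>)))"
      using run exec_deterministic by metis
  qed (use output_cond_gaussian eps_opt all_acc exact memory in \<open>simp_all add: acc_def\<close>)
qed

end
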